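(* Let $V$ be a finite set and $(\omega_v)_{v\in V}$ a family of 1-forms on the upper half plane $H$ of cusp modular type, spanning a linear space stable with respect to the pull-backs by the modular transformations $$\sigma=\begin{pmatrix}0&-1\\1&0\end{pmatrix},\qquad\tau=\begin{pmatrix}1&-1\\1&0\end{pmatrix}.$$ Then $$\sigma_*(J_0^{i\infty}(\omega_V))\cdot J_0^{i\infty}(\omega_V)=1,$$ $$\tau_*^2(J_0^{i\infty}(\omega_V))\cdot\tau_*(J_0^{i\infty}(\omega_V))\cdot J_0^{i\infty}(\omega_V)=1.$$
   Context: A 1-form of cusp modular type on $H$ is a form $f(z)z^{s-1}dz$ with $s\in\mathbb{C}$ and $f$ a cusp form of some weight with respect to a congruence subgroup of $SL_2(\mathbb{Z})$ (here $z^{s-1}=e^{(s-1)\log z}$, $0<\arg z<\pi$). $\mathbb{C}\langle\langle A_V\rangle\rangle$ is the ring of associative formal power series in free noncommuting variables $A_v$, $v\in V$. With $\delta:(0,1)\to H$ the geodesic (imaginary half-axis) from $0$ to $i\infty$, $$I_0^{i\infty}(\omega_1,\dots,\omega_n)=\int_{1>t_1>\dots>t_n>0}\delta^*\omega_1(t_1)\cdots\delta^*\omega_n(t_n)$$ (absolutely convergent for the forms considered), and $$J_0^{i\infty}(\omega_V)=1+\sum_{n\ge1}\sum_{(v_1,\dots,v_n)\in V^n}A_{v_1}\cdots A_{v_n}\,I_0^{i\infty}(\omega_{v_1},\dots,\omega_{v_n}).$$ For $g\in\{\sigma,\tau\}$, acting on $H$ by fractional linear transformations, let $(g_{vu})$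 be a complex matrix with $g^*(\omega_v)=\sum_ug_{vu}\omega_u$; then $g_*$ is the continuous $\mathbb{C}$-algebra endomorphism of $\mathbb{C}\langle\langle A_V\rangle\rangle$ with $g_*(A_u)=\sum_vA_vg_{vu}$. $\tau_*^2$ denotes $\tau_*\circ\tau_*$. *)

theory Defs
  imports
    "HOL-Complex_Analysis.Complex_Analysis"
    "HOL-Algebra.Group"
    "HOL-Number_Theory.Cong"
begin

section \<open>Forms of cusp modular type\<close>

definition upper_half_plane :: "complex set" where
  "upper_half_plane = {z. Im z > 0}"

definition SL2Z :: "(int^2^2) monoid" where
  "SL2Z = \<lparr>carrier = {A. det A = 1}, monoid.mult = (**), one = mat 1\<rparr>"

definition principal_congruence_subgroup :: "nat \<Rightarrow> (int^2^2) set" where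
  "principal_congruence_subgroup N =
     {A \<in> carrier SL2Z. \<forall>i j. [A $ i $ j = mat 1 $ i $ j] (mod int N)}"

definition congruence_subgroup :: "(int^2^2) set \<Rightarrow> bool" where
  "congruence_subgroup \<Gamma> \<longleftrightarrow>
     subgroup \<Gamma> SL2Z \<and> (\<exists>N\<ge>1. principal_congruence_subgroup N \<subseteq> \<Gamma>)"

definition moebius :: "int^2^2 \<Rightarrow> complex \<Rightarrow> complex" where
  "moebius A z = (of_int (A$1$1) * z + of_int (A$1$2)) / (of_int (A$2$1) * z + of_int (A$2$2))"

definition slash :: "int \<Rightarrow> (complex \<Rightarrow> complex) \<Rightarrow> int^2^2 \<Rightarrow> complex \<Rightarrow> complex" where
  "slash k f A z = (of_int (A$2$1) * z + of_int (A$2$2)) powi (- k) * f (moebius A z)"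

text \<open>The last condition says that at every cusp (every translate by \<open>A\<close> in the full modular
  group) there is an expansion in powers of \<open>exp (2 \<pi> \<i> z / N)\<close>, for some width \<open>N\<close>,
  with only positive exponents.\<close>
definition cusp_form :: "(int^2^2) set \<Rightarrow> int \<Rightarrow> (complex \<Rightarrow> complex) \<Rightarrow> bool" where
  "cusp_form \<Gamma> k f \<longleftrightarrow>
     f holomorphic_on upper_half_plane \<and>
     (\<forall>A\<in>\<Gamma>. \<forall>z\<in>upper_half_plane. slash k f A z = f z) \<and>
     (\<forall>A\<in>carrier SL2Z. \<exists>N::nat. N \<ge> 1 \<and> (\<exists>a :: nat \<Rightarrow> complex. a 0 = 0 \<and>
        (\<forall>z\<in>upper_half_plane.
           (\<lambda>n. a n * exp (2 * of_real pi * \<i> * of_nat n * z / of_nat N)) sums slash k f A z)))"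

text \<open>A 1-form \<open>F(z) dz\<close> on the upper half plane is represented by its coefficient \<open>F\<close>;
  only the values on the upper half plane are meaningful.\<close>
type_synonym one_form = "complex \<Rightarrow> complex"

text \<open>\<open>powr\<close> uses the principal logarithm, whose imaginary part on the upper half plane is
  the argument in \<open>(0, \<pi>)\<close>.\<close>
definition cusp_modular_type :: "one_form \<Rightarrow> bool" where
  "cusp_modular_type F \<longleftrightarrow>
     (\<exists>\<Gamma> k f. \<exists>s::complex. congruence_subgroup \<Gamma> \<and> cusp_form \<Gamma> k f \<and>
        (\<forall>z\<in>upper_half_plane. F z = f z * z powr (s - 1)))"

definition pullback :: "(complex \<Rightarrow> complex) \<Rightarrow> one_form \<Rightarrow> one_form" where
  "pullback h F z = F (h z) * deriv h z"

definition form_span :: "'v set \<Rightarrow> ('v \<Rightarrow> one_form) \<Rightarrow> one_form set" where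
  "form_span V \<omega> = {\<eta>. \<exists>c. \<forall>z\<in>upper_half_plane. \<eta> z = (\<Sum>v\<in>V. c v * \<omega> v z)}"

definition span_stable :: "int^2^2 \<Rightarrow> 'v set \<Rightarrow> ('v \<Rightarrow> one_form) \<Rightarrow> bool" where
  "span_stable g V \<omega> \<longleftrightarrow> (\<forall>\<eta>\<in>form_span V \<omega>. pullback (moebius g) \<eta> \<in> form_span V \<omega>)"

definition pullback_matrix ::
    "int^2^2 \<Rightarrow> 'v set \<Rightarrow> ('v \<Rightarrow> one_form) \<Rightarrow> ('v \<Rightarrow> 'v \<Rightarrow> complex) \<Rightarrow> bool" where
  "pullback_matrix g V \<omega> M \<longleftrightarrow>
     (\<forall>v\<in>V. \<forall>z\<in>upper_half_plane.
        pullback (moebius g) (\<omega> v) z = (\<Sum>u\<in>V. M v u * \<omega> u z))"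

lemma span_stable_imp_pullback_matrix:
  assumes "finite V" "span_stable g V \<omega>"
  shows "\<exists>M. pullback_matrix g V \<omega> M"
proof -
  have "\<exists>c. \<forall>z\<in>upper_half_plane. pullback (moebius g) (\<omega> v) z = (\<Sum>u\<in>V. c u * \<omega> u z)"
    if "v \<in> V" for v
  proof -
    have "(\<Sum>u\<in>V. (if u = v then 1 else 0) * \<omega> u z) = \<omega> v z" for z
    proof -
      have "(\<Sum>u\<in>V. (if u = v then 1 else 0) * \<omega> u z) = (\<Sum>u\<in>V. if u = v then \<omega> u z else 0)"
        by (rule sum.cong) auto
      then show ?thesis using assms(1) that by simp
    qed
    then have "\<omega> v \<in> form_span V \<omega>"
      unfolding form_span_def by (intro CollectI exI[of _ "\<lambda>u. if u = v then 1 else 0"]) simp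
    with assms(2) have "pullback (moebius g) (\<omega> v) \<in> form_span V \<omega>"
      unfolding span_stable_def by blast
    then show ?thesis unfolding form_span_def by simp
  qed
  then show ?thesis
    unfolding pullback_matrix_def by metis
qed

definition sigma_mat :: "int^2^2" where
  "sigma_mat = vector [vector [0, -1], vector [1, 0]]"

definition tau_mat :: "int^2^2" where
  "tau_mat = vector [vector [1, -1], vector [1, 0]]"


section \<open>Iterated integrals from \<open>0\<close> to \<open>\<i>\<infinity>\<close>\<close>

text \<open>A parametrization of the imaginary half-axis by \<open>(0, 1)\<close>, from \<open>0\<close> to \<open>\<i>\<infinity>\<close>.\<close>
definition imag_geodesic :: "real \<Rightarrow> complex" where
  "imag_geodesic t = \<i> * of_real (t / (1 - t))"

definition path_pullback :: "one_form \<Rightarrow> real \<Rightarrow> complex" where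
  "path_pullback F t = F (imag_geodesic t) * vector_derivative imag_geodesic (at t)"

definition open_simplex :: "nat \<Rightarrow> (nat \<Rightarrow> real) set" where
  "open_simplex n = {t. (\<forall>i<n. 0 < t i \<and> t i < 1) \<and> (\<forall>i j. i < j \<and> j < n \<longrightarrow> t i > t j)}"

definition iterated_integral :: "one_form list \<Rightarrow> complex" where
  "iterated_integral Fs =
     (LINT t : open_simplex (length Fs) | (\<Pi>\<^sub>M i\<in>{..<length Fs}. lborel).
        (\<Prod>i<length Fs. path_pullback (Fs ! i) (t i)))"


section \<open>Formal power series in noncommuting variables\<close>

text \<open>A series is given by its coefficients on words. The variables are indexed by the whole type
  \<open>'v\<close>; the series in the variables from a set \<open>V\<close> form the subset \<open>ncps_on V\<close> below.\<close>
typedef 'v ncps = "UNIV :: ('v list \<Rightarrow> complex) set"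
  morphisms nc_coeff Abs_ncps ..

setup_lifting type_definition_ncps

lemma ncps_eqI: "(\<And>w. nc_coeff f w = nc_coeff g w) \<Longrightarrow> f = g"
  by transfer auto

lemma ncps_assoc_aux:
  fixes F :: "nat \<Rightarrow> nat \<Rightarrow> complex"
  shows "(\<Sum>i\<le>n. \<Sum>j\<le>i. F j (i - j)) = (\<Sum>j\<le>n. \<Sum>i\<le>n - j. F j i)"
proof -
  have "(\<Sum>(i,j)\<in>{(i,j). i + j \<le> n}. F i j) = (\<Sum>i\<le>n. \<Sum>j\<le>i. F j (i - j))"
    by (rule sum.triangle_reindex_eq)
  moreover have "{(i,j). i + j \<le> n} = (SIGMA i:{..n}. {..n - i})" by auto
  ultimately show ?thesis by (simp add: sum.Sigma)
qed

instantiation ncps :: (type) ring_1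
begin

lift_definition zero_ncps :: "'a ncps" is "\<lambda>_. 0" .
lift_definition one_ncps :: "'a ncps" is "\<lambda>w. if w = [] then 1 else 0" .
lift_definition plus_ncps :: "'a ncps \<Rightarrow> 'a ncps \<Rightarrow> 'a ncps" is "\<lambda>f g w. f w + g w" .
lift_definition minus_ncps :: "'a ncps \<Rightarrow> 'a ncps \<Rightarrow> 'a ncps" is "\<lambda>f g w. f w - g w" .
lift_definition uminus_ncps :: "'a ncps \<Rightarrow> 'a ncps" is "\<lambda>f w. - f w" .
lift_definition times_ncps :: "'a ncps \<Rightarrow> 'a ncps \<Rightarrow> 'a ncps"
  is "\<lambda>f g w. \<Sum>i\<le>length w. f (take i w) * g (drop i w)" .

instance
proof
  fix a b c :: "'a ncps"
  show "a * b * c = a * (b * c)"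
  proof (transfer, rule ext)
    fix a b c :: "'a list \<Rightarrow> complex" and w :: "'a list"
    let ?n = "length w"
    let ?F = "\<lambda>j i. a (take j w) * b (take i (drop j w)) * c (drop (i + j) w)"
    have "(\<Sum>i\<le>?n. (\<Sum>j\<le>length (take i w). a (take j (take i w)) * b (drop j (take i w))) * c (drop i w))
        = (\<Sum>i\<le>?n. \<Sum>j\<le>i. ?F j (i - j))"
    proof (rule sum.cong[OF refl])
      fix i assume "i \<in> {..?n}"
      then have "length (take i w) = i" by simp
      then show "(\<Sum>j\<le>length (take i w). a (take j (take i w)) * b (drop j (take i w))) * c (drop i w)
        = (\<Sum>j\<le>i. ?F j (i - j))"
        by (auto simp: sum_distrib_right drop_take min_def intro!: sum.cong)
    qed
    also have "\<dots> = (\<Sum>j\<le>?n. \<Sum>i\<le>?n - j. ?F j i)" by (rule ncps_assoc_aux)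
    also have "\<dots> = (\<Sum>j\<le>?n. a (take j w) *
        (\<Sum>i\<le>length (drop j w). b (take i (drop j w)) * c (drop i (drop j w))))"
      by (simp add: sum_distrib_left mult.assoc)
    finally show "(\<Sum>i\<le>?n. (\<Sum>j\<le>length (take i w). a (take j (take i w)) * b (drop j (take i w))) * c (drop i w))
       = (\<Sum>j\<le>?n. a (take j w) *
        (\<Sum>i\<le>length (drop j w). b (take i (drop j w)) * c (drop i (drop j w))))" .
  qed
  show "1 * a = a"
  proof (transfer, rule ext)
    fix a :: "'a list \<Rightarrow> complex" and w :: "'a list"
    have "(\<Sum>i\<le>length w. (if take i w = [] then 1 else 0) * a (drop i w))
        = (\<Sum>i\<le>length w. if i = 0 then a w else 0)"
      by (rule sum.cong) auto
    then show "(\<Sum>i\<le>length w. (if take i w = [] then 1 else 0) * a (drop i w)) = a w" by simp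
  qed
  show "a * 1 = a"
  proof (transfer, rule ext)
    fix a :: "'a list \<Rightarrow> complex" and w :: "'a list"
    have "(\<Sum>i\<le>length w. a (take i w) * (if drop i w = [] then 1 else 0))
        = (\<Sum>i\<le>length w. if i = length w then a w else 0)"
      by (rule sum.cong) auto
    then show "(\<Sum>i\<le>length w. a (take i w) * (if drop i w = [] then 1 else 0)) = a w" by simp
  qed
  show "(0::'a ncps) \<noteq> 1" by transfer (auto dest: fun_cong[of _ _ "[]"])
qed (transfer; auto simp: algebra_simps sum.distrib)+

end

text \<open>The topology in which the series divisible by long words are small: \<open>g\<close> is close to \<open>f\<close>
  when their coefficients agree on all words of length less than a large \<open>n\<close>.\<close>
instantiation ncps :: (type) topological_space
begin

definition open_ncps :: "'a ncps set \<Rightarrow> bool" where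
  "open_ncps U \<longleftrightarrow>
     (\<forall>f\<in>U. \<exists>n. \<forall>g. (\<forall>w. length w < n \<longrightarrow> nc_coeff g w = nc_coeff f w) \<longrightarrow> g \<in> U)"

instance
proof
  show "open (UNIV :: 'a ncps set)" by (simp add: open_ncps_def)
next
  fix S T :: "'a ncps set"
  assume S: "open S" and T: "open T"
  show "open (S \<inter> T)"
    unfolding open_ncps_def
  proof
    fix f assume "f \<in> S \<inter> T"
    with S T obtain m n where
      "\<And>g. (\<forall>w. length w < m \<longrightarrow> nc_coeff g w = nc_coeff f w) \<Longrightarrow> g \<in> S"
      "\<And>g. (\<forall>w. length w < n \<longrightarrow> nc_coeff g w = nc_coeff f w) \<Longrightarrow> g \<in> T"
      unfolding open_ncps_def by (metis IntD1 IntD2)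
    then show "\<exists>n. \<forall>g. (\<forall>w. length w < n \<longrightarrow> nc_coeff g w = nc_coeff f w) \<longrightarrow> g \<in> S \<inter> T"
      by (intro exI[of _ "max m n"]) auto
  qed
next
  fix K :: "'a ncps set set"
  assume "\<forall>S\<in>K. open S"
  then show "open (\<Union>K)" unfolding open_ncps_def by (meson UnionE UnionI)
qed

end

definition nc_scale :: "complex \<Rightarrow> 'v ncps \<Rightarrow> 'v ncps" where
  "nc_scale c f = Abs_ncps (\<lambda>w. c * nc_coeff f w)"

definition nc_var :: "'v \<Rightarrow> 'v ncps" where
  "nc_var v = Abs_ncps (\<lambda>w. if w = [v] then 1 else 0)"

definition ncps_on :: "'v set \<Rightarrow> 'v ncps set" where
  "ncps_on V = {f. \<forall>w. \<not> set w \<subseteq> V \<longrightarrow> nc_coeff f w = 0}"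

text \<open>Continuous unital algebra endomorphisms of \<open>ncps_on V\<close>; the values outside are irrelevant.\<close>
definition continuous_algebra_endo :: "'v set \<Rightarrow> ('v ncps \<Rightarrow> 'v ncps) \<Rightarrow> bool" where
  "continuous_algebra_endo V \<phi> \<longleftrightarrow>
     \<phi> ` ncps_on V \<subseteq> ncps_on V \<and>
     \<phi> 1 = 1 \<and>
     (\<forall>f\<in>ncps_on V. \<forall>g\<in>ncps_on V. \<phi> (f + g) = \<phi> f + \<phi> g) \<and>
     (\<forall>f\<in>ncps_on V. \<forall>g\<in>ncps_on V. \<phi> (f * g) = \<phi> f * \<phi> g) \<and>
     (\<forall>c. \<forall>f\<in>ncps_on V. \<phi> (nc_scale c f) = nc_scale c (\<phi> f)) \<and>
     continuous_on (ncps_on V) \<phi>"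

text \<open>The endomorphism with matrix \<open>M\<close>; note the transposition of indices. Existence and
  uniqueness on \<open>ncps_on V\<close> are shown at the end of this theory.\<close>
definition induced_endo :: "'v set \<Rightarrow> ('v \<Rightarrow> 'v \<Rightarrow> complex) \<Rightarrow> ('v ncps \<Rightarrow> 'v ncps) \<Rightarrow> bool" where
  "induced_endo V M \<phi> \<longleftrightarrow>
     continuous_algebra_endo V \<phi> \<and>
     (\<forall>u\<in>V. \<phi> (nc_var u) = (\<Sum>v\<in>V. nc_scale (M v u) (nc_var v)))"

text \<open>The total iterated integral: the coefficient of \<open>A\<^sub>v\<^sub>1\<dots>A\<^sub>v\<^sub>n\<close> is the iterated integral of
  \<open>\<omega>\<^sub>v\<^sub>1, \<dots>, \<omega>\<^sub>v\<^sub>n\<close>.\<close>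
definition J_series :: "'v set \<Rightarrow> ('v \<Rightarrow> one_form) \<Rightarrow> 'v ncps" where
  "J_series V \<omega> = Abs_ncps (\<lambda>w. if w = [] then 1
     else if set w \<subseteq> V then iterated_integral (map \<omega> w) else 0)"


section \<open>Existence and uniqueness of the induced endomorphism\<close>

lemma nc_coeff_simps [simp]:
  "nc_coeff 0 w = 0" "nc_coeff 1 w = (if w = [] then 1 else 0)"
  "nc_coeff (f + g) w = nc_coeff f w + nc_coeff g w"
  "nc_coeff (nc_scale c f) w = c * nc_coeff f w"
  "nc_coeff (nc_var v) w = (if w = [v] then 1 else 0)"
  by (simp_all add: zero_ncps.rep_eq one_ncps.rep_eq plus_ncps.rep_eq nc_scale_def nc_var_def
      Abs_ncps_inverse)

lemma nc_coeff_mult: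
  "nc_coeff (f * g) w = (\<Sum>i\<le>length w. nc_coeff f (take i w) * nc_coeff g (drop i w))"
  by (simp add: times_ncps.rep_eq)

lemma nc_coeff_sum: "nc_coeff (sum f A) w = (\<Sum>x\<in>A. nc_coeff (f x) w)"
  by (induction A rule: infinite_finite_induct) simp_all

lemma nc_coeff_J_series:
  "nc_coeff (J_series V \<omega>) w = (if w = [] then 1
     else if set w \<subseteq> V then iterated_integral (map \<omega> w) else 0)"
  by (simp add: J_series_def Abs_ncps_inverse)

definition words :: "'v set \<Rightarrow> nat \<Rightarrow> 'v list set" where
  "words V n = {u. set u \<subseteq> V \<and> length u = n}"

definition word_weight :: "('v \<Rightarrow> 'v \<Rightarrow> complex) \<Rightarrow> 'v list \<Rightarrow> 'v list \<Rightarrow> complex" where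
  "word_weight M w u = prod_list (map2 M w u)"

definition linear_subst :: "'v set \<Rightarrow> ('v \<Rightarrow> 'v \<Rightarrow> complex) \<Rightarrow> 'v ncps \<Rightarrow> 'v ncps" where
  "linear_subst V M f = Abs_ncps (\<lambda>w. if set w \<subseteq> V
     then \<Sum>u\<in>words V (length w). word_weight M w u * nc_coeff f u else 0)"

lemma nc_coeff_linear_subst:
  "nc_coeff (linear_subst V M f) w = (if set w \<subseteq> V
     then \<Sum>u\<in>words V (length w). word_weight M w u * nc_coeff f u else 0)"
  by (simp add: linear_subst_def Abs_ncps_inverse)

lemma finite_words: "finite V \<Longrightarrow> finite (words V n)"
  unfolding words_def by (rule finite_lists_length_eq)

lemma words_0 [simp]: "words V 0 = {[]}"
  by (auto simp: words_def)

lemma word_weight_split: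
  assumes "length u = length w"
  shows "word_weight M w u = word_weight M (take i w) (take i u) * word_weight M (drop i w) (drop i u)"
proof -
  have "zip w u = zip (take i w) (take i u) @ zip (drop i w) (drop i u)"
    by (metis append_take_drop_id take_zip drop_zip)
  then show ?thesis unfolding word_weight_def by (metis map_append prod_list.append)
qed

lemma sum_words_split:
  fixes F G :: "'v list \<Rightarrow> complex"
  assumes "i \<le> n"
  shows "(\<Sum>u\<in>words V n. F (take i u) * G (drop i u))
    = (\<Sum>p\<in>words V i. F p) * (\<Sum>q\<in>words V (n - i). G q)"
proof -
  have "(\<Sum>u\<in>words V n. F (take i u) * G (drop i u))
      = (\<Sum>(p, q)\<in>words V i \<times> words V (n - i). F p * G q)"
    by (rule sum.reindex_bij_witness[where i = "\<lambda>(p, q). p @ q" and j = "\<lambda>u. (take i u, drop i u)"])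
      (use assms in \<open>auto simp: words_def dest: in_set_takeD in_set_dropD\<close>)
  then show ?thesis by (simp add: sum.cartesian_product sum_product)
qed

lemma linear_subst_mult:
  fixes f g :: "'v ncps"
  shows "linear_subst V M (f * g) = linear_subst V M f * linear_subst V M g"
proof (rule ncps_eqI)
  fix w :: "'v list"
  let ?n = "length w"
  show "nc_coeff (linear_subst V M (f * g)) w = nc_coeff (linear_subst V M f * linear_subst V M g) w"
  proof (cases "set w \<subseteq> V")
    case False
    have "nc_coeff (linear_subst V M f) (take i w) * nc_coeff (linear_subst V M g) (drop i w) = 0" for i
    proof -
      have "set w = set (take i w) \<union> set (drop i w)"
        by (metis append_take_drop_id set_append)
      with False have "\<not> set (take i w) \<subseteq> V \<or> \<not> set (drop i w) \<subseteq> V" by blast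
      then show ?thesis by (elim disjE) (simp_all only: nc_coeff_linear_subst if_False mult_zero_left mult_zero_right)
    qed
    moreover have "nc_coeff (linear_subst V M (f * g)) w = 0"
      using False by (simp only: nc_coeff_linear_subst if_False)
    ultimately show ?thesis
      by (simp only: nc_coeff_mult sum.neutral_const)
  next
    case True
    have sub: "set (take i w) \<subseteq> V" "set (drop i w) \<subseteq> V" for i
      using True by (auto dest: in_set_takeD in_set_dropD)
    have "nc_coeff (linear_subst V M (f * g)) w
      = (\<Sum>u\<in>words V ?n. \<Sum>i\<le>?n. (word_weight M (take i w) (take i u) * nc_coeff f (take i u)) *
           (word_weight M (drop i w) (drop i u) * nc_coeff g (drop i u)))"
    proof -
      have "word_weight M w u * nc_coeff (f * g) u
        = (\<Sum>i\<le>?n. (word_weight M (take i w) (take i u) * nc_coeff f (take i u)) *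
           (word_weight M (drop i w) (drop i u) * nc_coeff g (drop i u)))"
        if "u \<in> words V ?n" for u
      proof -
        from that have len: "length u = ?n" by (simp add: words_def)
        show ?thesis
          unfolding nc_coeff_mult len sum_distrib_left
        proof (rule sum.cong[OF refl])
          fix i
          show "word_weight M w u * (nc_coeff f (take i u) * nc_coeff g (drop i u))
            = (word_weight M (take i w) (take i u) * nc_coeff f (take i u)) *
              (word_weight M (drop i w) (drop i u) * nc_coeff g (drop i u))"
            unfolding word_weight_split[OF len, of M i] by (simp only: mult_ac)
        qed
      qed
      then show ?thesis
        using True by (simp only: nc_coeff_linear_subst if_True cong: sum.cong)
    qed
    also have "\<dots> = (\<Sum>i\<le>?n. \<Sum>u\<in>words V ?n. (word_weight M (take i w) (take i u) * nc_coeff f (take i u)) *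
           (word_weight M (drop i w) (drop i u) * nc_coeff g (drop i u)))"
      by (rule sum.swap)
    also have "\<dots> = (\<Sum>i\<le>?n. (\<Sum>p\<in>words V i. word_weight M (take i w) p * nc_coeff f p) *
           (\<Sum>q\<in>words V (?n - i). word_weight M (drop i w) q * nc_coeff g q))"
      by (rule sum.cong[OF refl], rule sum_words_split) simp
    also have "\<dots> = nc_coeff (linear_subst V M f * linear_subst V M g) w"
      unfolding nc_coeff_mult nc_coeff_linear_subst using sub
      by (intro sum.cong) (simp_all add: min_def)
    finally show ?thesis .
  qed
qed

lemma induced_endo_linear_subst:
  assumes "finite V"
  shows "induced_endo V M (linear_subst V M)"
  unfolding induced_endo_def continuous_algebra_endo_def
proof (intro conjI ballI allI)
  show "linear_subst V M ` ncps_on V \<subseteq> ncps_on V"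
    by (auto simp: ncps_on_def nc_coeff_linear_subst split: if_splits)
  show "linear_subst V M 1 = 1"
  proof (rule ncps_eqI)
    fix w
    show "nc_coeff (linear_subst V M 1) w = nc_coeff 1 w"
    proof (cases "w = []")
      case False
      then show ?thesis by (auto simp: nc_coeff_linear_subst words_def intro!: sum.neutral)
    qed (simp add: nc_coeff_linear_subst word_weight_def)
  qed
  fix f g :: "'a ncps" and c
  show "linear_subst V M (f + g) = linear_subst V M f + linear_subst V M g"
    by (rule ncps_eqI) (simp add: nc_coeff_linear_subst distrib_left sum.distrib)
  show "linear_subst V M (f * g) = linear_subst V M f * linear_subst V M g"
    by (rule linear_subst_mult)
  show "linear_subst V M (nc_scale c f) = nc_scale c (linear_subst V M f)"
    by (rule ncps_eqI) (simp add: nc_coeff_linear_subst sum_distrib_left mult.left_commute)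
next
  have "open (linear_subst V M -` U)" if "open U" for U
    unfolding open_ncps_def
  proof
    fix f assume "f \<in> linear_subst V M -` U"
    with that obtain n where n:
      "\<And>g. (\<forall>w. length w < n \<longrightarrow> nc_coeff g w = nc_coeff (linear_subst V M f) w) \<Longrightarrow> g \<in> U"
      unfolding open_ncps_def by blast
    have "linear_subst V M g \<in> U" if g: "\<forall>w. length w < n \<longrightarrow> nc_coeff g w = nc_coeff f w" for g
      by (rule n) (use g in \<open>auto simp: nc_coeff_linear_subst words_def intro!: sum.cong\<close>)
    then show "\<exists>n. \<forall>g. (\<forall>w. length w < n \<longrightarrow> nc_coeff g w = nc_coeff f w) \<longrightarrow> g \<in> linear_subst V M -` U"
      by blast
  qed
  then have "continuous_on UNIV (linear_subst V M)"
    by (simp add: continuous_on_open_vimage)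
  then show "continuous_on (ncps_on V) (linear_subst V M)"
    by (rule continuous_on_subset) simp
next
  fix u assume u: "u \<in> V"
  show "linear_subst V M (nc_var u) = (\<Sum>v\<in>V. nc_scale (M v u) (nc_var v))"
  proof (rule ncps_eqI)
    fix w
    show "nc_coeff (linear_subst V M (nc_var u)) w
      = nc_coeff (\<Sum>v\<in>V. nc_scale (M v u) (nc_var v)) w"
    proof (cases "\<exists>v\<in>V. w = [v]")
      case True
      then obtain v where v: "v \<in> V" "w = [v]" by blast
      have "(\<Sum>x\<in>words V 1. word_weight M [v] x * (if x = [u] then 1 else 0))
          = (\<Sum>x\<in>words V 1. if x = [u] then word_weight M [v] x else 0)"
        by (rule sum.cong) auto
      also have "\<dots> = M v u"
        using u assms by (simp add: finite_words sum.delta') (simp add: words_def word_weight_def)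
      finally show ?thesis using v assms
        by (simp add: nc_coeff_linear_subst nc_coeff_sum if_distrib[of "\<lambda>x. _ * x"] cong: if_cong)
    next
      case False
      then have "nc_coeff (\<Sum>v\<in>V. nc_scale (M v u) (nc_var v)) w = 0"
        by (auto simp: nc_coeff_sum intro!: sum.neutral)
      moreover have "nc_coeff (linear_subst V M (nc_var u)) w = 0"
      proof (cases "set w \<subseteq> V")
        case True
        with False have len: "length w \<noteq> 1" by (auto simp: length_Suc_conv)
        have "[u] \<notin> words V (length w)" using len by (auto simp: words_def)
        then have "(\<Sum>x\<in>words V (length w). word_weight M w x * nc_coeff (nc_var u) x) = 0"
          by (intro sum.neutral) auto
        then show ?thesis by (simp add: nc_coeff_linear_subst)
      qed (simp add: nc_coeff_linear_subst)
      ultimately show ?thesis by simp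
    qed
  qed
qed

definition nc_monom :: "'v list \<Rightarrow> 'v ncps" where
  "nc_monom w = prod_list (map nc_var w)"

lemma nc_coeff_var_mult:
  "nc_coeff (nc_var v * f) w = (case w of [] \<Rightarrow> 0 | x # xs \<Rightarrow> if x = v then nc_coeff f xs else 0)"
proof (cases w)
  case (Cons x xs)
  have "nc_coeff (nc_var v * f) w
    = (\<Sum>i\<le>length w. if i = 1 then (if x = v then nc_coeff f xs else 0) else 0)"
    unfolding nc_coeff_mult
  proof (rule sum.cong[OF refl])
    fix i assume "i \<in> {..length w}"
    then show "nc_coeff (nc_var v) (take i w) * nc_coeff f (drop i w)
      = (if i = 1 then (if x = v then nc_coeff f xs else 0) else 0)"
      by (cases i) (auto simp: Cons)
  qed
  also have "\<dots> = (if x = v then nc_coeff f xs else 0)"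
    by (subst sum.delta) (auto simp: Cons)
  finally show ?thesis by (simp add: Cons)
qed (simp add: nc_coeff_mult)

lemma nc_coeff_monom [simp]: "nc_coeff (nc_monom u) w = (if w = u then 1 else 0)"
proof (induction u arbitrary: w)
  case (Cons a u)
  have "nc_monom (a # u) = nc_var a * nc_monom u" by (simp add: nc_monom_def)
  with Cons show ?case by (auto simp: nc_coeff_var_mult split: list.splits)
qed (simp add: nc_monom_def)

lemma nc_var_in: "v \<in> V \<Longrightarrow> nc_var v \<in> ncps_on V"
  by (auto simp: ncps_on_def)

lemma nc_monom_in: "set u \<subseteq> V \<Longrightarrow> nc_monom u \<in> ncps_on V"
  by (auto simp: ncps_on_def)

lemma nc_scale_in: "f \<in> ncps_on V \<Longrightarrow> nc_scale c f \<in> ncps_on V"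
  by (auto simp: ncps_on_def)

lemma ncps_sum_in: "(\<And>x. x \<in> A \<Longrightarrow> f x \<in> ncps_on V) \<Longrightarrow> sum f A \<in> ncps_on V"
  by (auto simp: ncps_on_def nc_coeff_sum intro!: sum.neutral)

lemma J_series_in: "J_series V \<omega> \<in> ncps_on V"
  by (auto simp: ncps_on_def nc_coeff_J_series)

lemma endo_sum:
  assumes "continuous_algebra_endo V \<phi>" "finite A" "\<And>x. x \<in> A \<Longrightarrow> f x \<in> ncps_on V"
  shows "\<phi> (sum f A) = (\<Sum>x\<in>A. \<phi> (f x))"
  using assms(2,3)
proof (induction A rule: finite_induct)
  case empty
  have "(0 :: 'a ncps) \<in> ncps_on V" by (simp add: ncps_on_def)
  with assms(1) have "\<phi> (0 + 0) = \<phi> 0 + \<phi> 0" unfolding continuous_algebra_endo_def by blast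
  then show ?case by simp
next
  case (insert x A)
  then have "sum f A \<in> ncps_on V" "f x \<in> ncps_on V" by (auto intro: ncps_sum_in)
  with insert assms(1) show ?case unfolding continuous_algebra_endo_def by simp
qed

lemma induced_endo_monom:
  assumes "induced_endo V M \<phi>" "induced_endo V M \<psi>" "set u \<subseteq> V"
  shows "\<phi> (nc_monom u) = \<psi> (nc_monom u)"
  using assms(3)
proof (induction u)
  case Nil
  with assms(1,2) show ?case
    by (simp add: nc_monom_def induced_endo_def continuous_algebra_endo_def)
next
  case (Cons a u)
  have eq: "nc_monom (a # u) = nc_var a * nc_monom u" by (simp add: nc_monom_def)
  from Cons.prems have a: "a \<in> V" and u: "set u \<subseteq> V" by auto
  from assms(1,2) a u show ?case
    unfolding eq induced_endo_def continuous_algebra_endo_def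
    using Cons.IH[OF u] nc_var_in[OF a] nc_monom_in[OF u] by simp
qed

lemma induced_endo_unique:
  assumes "finite V" "induced_endo V M \<phi>" "induced_endo V M \<psi>" "f \<in> ncps_on V"
  shows "\<phi> f = \<psi> f"
proof (rule ncps_eqI)
  fix w
  have *: "\<exists>m. \<forall>g\<in>ncps_on V. (\<forall>u. length u < m \<longrightarrow> nc_coeff g u = nc_coeff f u) \<longrightarrow>
      nc_coeff (\<theta> g) w = nc_coeff (\<theta> f) w" if "induced_endo V M \<theta>" for \<theta>
  proof -
    let ?U = "{g. nc_coeff g w = nc_coeff (\<theta> f) w}"
    have "open ?U"
      unfolding open_ncps_def by (auto intro!: exI[of _ "Suc (length w)"])
    moreover have "continuous_on (ncps_on V) \<theta>"
      using that by (simp add: induced_endo_def continuous_algebra_endo_def)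
    ultimately obtain A where A: "open A" "A \<inter> ncps_on V = \<theta> -` ?U \<inter> ncps_on V"
      unfolding continuous_on_open_invariant by blast
    with assms(4) have "f \<in> A" by auto
    with A(1) obtain m where
      "\<And>g. (\<forall>u. length u < m \<longrightarrow> nc_coeff g u = nc_coeff f u) \<Longrightarrow> g \<in> A"
      unfolding open_ncps_def by blast
    with A(2) show ?thesis by (intro exI[of _ m]) blast
  qed
  from *[OF assms(2)] *[OF assms(3)] obtain m n where
    m: "\<And>g. g \<in> ncps_on V \<Longrightarrow> (\<forall>u. length u < m \<longrightarrow> nc_coeff g u = nc_coeff f u) \<Longrightarrow>
      nc_coeff (\<phi> g) w = nc_coeff (\<phi> f) w" and
    n: "\<And>g. g \<in> ncps_on V \<Longrightarrow> (\<forall>u. length u < n \<longrightarrow> nc_coeff g u = nc_coeff f u) \<Longrightarrow>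
      nc_coeff (\<psi> g) w = nc_coeff (\<psi> f) w"
    by metis
  define B where "B = {u. set u \<subseteq> V \<and> length u \<le> max m n}"
  define g where "g = (\<Sum>u\<in>B. nc_scale (nc_coeff f u) (nc_monom u))"
  have finB: "finite B" unfolding B_def by (rule finite_lists_length_le[OF assms(1)])
  have in_V: "nc_scale (nc_coeff f u) (nc_monom u) \<in> ncps_on V" if "u \<in> B" for u
    using that by (auto simp: B_def intro: nc_scale_in nc_monom_in)
  then have g_in: "g \<in> ncps_on V" unfolding g_def by (rule ncps_sum_in)
  have g_coeff: "nc_coeff g u = nc_coeff f u" if "length u \<le> max m n" for u
  proof -
    have "nc_coeff g u = (\<Sum>x\<in>B. if u = x then nc_coeff f x else 0)"
      unfolding g_def nc_coeff_sum by (rule sum.cong) auto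
    also have "\<dots> = (if u \<in> B then nc_coeff f u else 0)" using finB by simp
    finally show ?thesis using that assms(4) by (auto simp: B_def ncps_on_def)
  qed
  have "\<phi> g = \<psi> g"
  proof -
    have endo: "continuous_algebra_endo V \<phi>" "continuous_algebra_endo V \<psi>"
      using assms(2,3) by (auto simp: induced_endo_def)
    have "\<phi> (nc_scale (nc_coeff f u) (nc_monom u)) = \<psi> (nc_scale (nc_coeff f u) (nc_monom u))"
      if "u \<in> B" for u
    proof -
      from that have u: "set u \<subseteq> V" by (simp add: B_def)
      show ?thesis
        using endo nc_monom_in[OF u] induced_endo_monom[OF assms(2,3) u]
        unfolding continuous_algebra_endo_def by simp
    qed
    moreover have "\<phi> g = (\<Sum>u\<in>B. \<phi> (nc_scale (nc_coeff f u) (nc_monom u)))"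
      unfolding g_def by (rule endo_sum[OF endo(1) finB in_V])
    moreover have "\<psi> g = (\<Sum>u\<in>B. \<psi> (nc_scale (nc_coeff f u) (nc_monom u)))"
      unfolding g_def by (rule endo_sum[OF endo(2) finB in_V])
    ultimately show ?thesis by simp
  qed
  moreover have "nc_coeff (\<phi> g) w = nc_coeff (\<phi> f) w" by (rule m[OF g_in]) (simp add: g_coeff)
  moreover have "nc_coeff (\<psi> g) w = nc_coeff (\<psi> f) w" by (rule n[OF g_in]) (simp add: g_coeff)
  ultimately show "nc_coeff (\<phi> f) w = nc_coeff (\<psi> f) w" by simp
qed

end

theory Submission
  imports Defs "HOL-Real_Asymp.Real_Asymp"
begin

text \<open>
  Let \<open>J\<^sub>0\<^sup>z\<close> be the total iterated integral from \<open>0\<close> to a point \<open>z\<close> of the upper half plane. It solves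
  \<open>dX = \<Omega> X\<close> with \<open>\<Omega> = \<Sum>v\<in>V. A\<^sub>v \<omega>\<^sub>v\<close>, and any two solutions that have the same limit at a cusp agree
  (\<open>horizontal_unique\<close>). For a modular transformation \<open>g\<close>, both \<open>g\<^sub>* (J\<^sub>0\<^sup>z)\<close> and \<open>J\<^sub>0\<^sup>g\<^sup>z\<close> solve the equation
  for the pulled back form, so they differ by a constant right factor. If \<open>g\<close> maps \<open>0\<close> to \<open>\<i>\<infinity>\<close>, as \<open>\<sigma>\<close> and \<open>\<tau>\<close>
  do, comparing the limits at \<open>z = 0\<close> identifies the factor with the total integral \<open>J\<close> from \<open>0\<close> to \<open>\<i>\<infinity>\<close>
  (\<open>path_series_transport\<close>).

  Letting \<open>z\<close> tend to \<open>\<i>\<infinity>\<close> in \<open>J\<^sub>0\<^sup>g\<^sup>z = g\<^sub>* (J\<^sub>0\<^sup>z) J\<close> gives the relation for \<open>\<sigma>\<close>, because \<open>\<sigma> z\<close> returns to \<open>0\<close>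
  (\<open>sigma_relation\<close>). For \<open>\<tau>\<close>, which permutes \<open>0\<close>, \<open>\<i>\<infinity>\<close> and \<open>1\<close> cyclically, the rule is applied twice
  (\<open>tau_relation\<close>). The limit of \<open>J\<^sub>0\<^sup>z\<close> at the cusp \<open>1\<close> is dictated by the rule. What has
  to be known in advance is that \<open>J\<^sub>0\<^sup>z\<close> has the same limit \<open>J\<close> at \<open>\<i>\<infinity>\<close> on all vertical lines with \<open>\<bar>Re z\<bar> \<le> 1\<close>
  (\<open>path_series_at_top\<close>). This follows from the decay of the forms, which itself rests on the missing
  constant term in the expansion of a cusp form at \<open>\<i>\<infinity>\<close>; stability under \<open>\<sigma>\<close> transfers the decay to \<open>0\<close>.

  The integrals over simplices are linked to holomorphic primitives by peeling off one
  variable at a time: the coefficients of \<open>J\<^sub>0\<^sup>z\<close> on the imaginary axis and the truncated iterated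
  integrals satisfy the same recursion (\<open>iterated_integral_eq_foldr_volterra\<close> and
  \<open>iterated_primitive_volterra\<close>).
\<close>

section \<open>Iterated integrals as iterated Volterra operators\<close>

definition volterra :: "(real \<Rightarrow> complex) \<Rightarrow> (real \<Rightarrow> complex) \<Rightarrow> real \<Rightarrow> complex" where
  "volterra p h x = (LINT s:{0<..<x}|lborel. p s * h s)"

lemma volterra_cong:
  assumes "\<And>s. s \<in> {0<..<x} \<Longrightarrow> h s = h' s"
  shows "volterra p h x = volterra p h' x"
  unfolding volterra_def using assms by (intro set_lebesgue_integral_cong) auto

text \<open>The bound makes \<open>p\<close> vanish outside the unit interval, so that integrability on the line and
  on products of lines needs no further localisation.\<close>
definition bounded_on_unit :: "real \<Rightarrow> (real \<Rightarrow> complex) \<Rightarrow> bool" where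
  "bounded_on_unit B p \<longleftrightarrow>
     p \<in> borel_measurable borel \<and> (\<forall>s. norm (p s) \<le> B * indicator {0<..<1} s)"

text \<open>The upper limit of the next, smaller integration variable. For \<open>n = 0\<close> no variable has been
  chosen yet and the limit is the endpoint \<open>1\<close> of the path.\<close>
definition last_time :: "nat \<Rightarrow> (nat \<Rightarrow> real) \<Rightarrow> real" where
  "last_time n t = (if n = 0 then 1 else t (n - 1))"

text \<open>The times decrease, so a further time below the last one is automatically below all the
  others; this is what lets the simplex be peeled one variable at a time.\<close>
lemma open_simplex_Suc:
  "t(n := y) \<in> open_simplex (Suc n) \<longleftrightarrow> t \<in> open_simplex n \<and> 0 < y \<and> y < last_time n t"
proof -
  have upd: "t(n := y) \<in> open_simplex (Suc n) \<longleftrightarrow>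
      t \<in> open_simplex n \<and> 0 < y \<and> y < 1 \<and> (\<forall>i<n. y < t i)"
    unfolding open_simplex_def by (auto simp: less_Suc_eq)
  show ?thesis
  proof (cases n)
    case 0
    then show ?thesis unfolding upd by (simp add: last_time_def)
  next
    case (Suc m)
    have "y < 1 \<and> (\<forall>i<n. y < t i) \<longleftrightarrow> y < t m" if t: "t \<in> open_simplex n"
    proof
      assume *: "y < t m"
      have "t m \<le> t i" if "i < n" for i
        using that t Suc unfolding open_simplex_def by (cases "i = m") (auto intro: less_imp_le)
      moreover have "t m < 1" using t Suc unfolding open_simplex_def by auto
      ultimately show "y < 1 \<and> (\<forall>i<n. y < t i)" using * by force
    qed (use Suc in auto)
    then show ?thesis unfolding upd using Suc by (auto simp: last_time_def)
  qed
qed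

lemma measurable_open_simplex [measurable]:
  "Measurable.pred (PiM {..<n} (\<lambda>_. lborel)) (\<lambda>t. t \<in> open_simplex n)"
proof -
  have "(\<lambda>t. t \<in> open_simplex n) = (\<lambda>t. (\<forall>i\<in>{..<n}. 0 < t i \<and> t i < 1) \<and>
     (\<forall>i\<in>{..<n}. \<forall>j\<in>{..<n}. i < j \<longrightarrow> t i > t j))"
    unfolding open_simplex_def by (auto simp: fun_eq_iff)
  moreover have "Measurable.pred (PiM {..<n} (\<lambda>_. lborel)) \<dots>"
    by measurable
  ultimately show ?thesis by simp
qed

lemma integrable_bounded_on_unit: "bounded_on_unit B p \<Longrightarrow> integrable lborel p"
  unfolding bounded_on_unit_def
  by (rule Bochner_Integration.integrable_bound[where f = "\<lambda>s. B * indicator {0<..<1} s"])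
     (auto intro: order_trans[OF _ abs_ge_self])

lemma measurable_last_time [measurable]:
  "last_time n \<in> borel_measurable (PiM {..<n} (\<lambda>_. lborel))"
proof (cases n)
  case 0
  then have "last_time n = (\<lambda>t. 1)" by (auto simp: last_time_def)
  then show ?thesis by simp
next
  case (Suc m)
  then have "last_time n = (\<lambda>t. t m)" by (auto simp: last_time_def)
  then show ?thesis using Suc by simp
qed

text \<open>Fubini for the variable with the largest index. It is the smallest time, and the other factors
  do not involve it, so integrating it out only replaces the function \<open>h\<close> of the last time by its
  Volterra transform. Keeping \<open>h\<close> general makes the induction below work without any reindexing.\<close>
lemma open_simplex_integral_Suc:
  fixes p :: "nat \<Rightarrow> real \<Rightarrow> complex"
  assumes p: "\<And>i. i \<le> n \<Longrightarrow> bounded_on_unit B (p i)"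
    and h: "h \<in> borel_measurable borel" "\<And>s. norm (h s) \<le> C"
  shows "(LINT t:open_simplex (Suc n)|PiM {..<Suc n} (\<lambda>_. lborel).
            (\<Prod>i<Suc n. p i (t i)) * h (last_time (Suc n) t))
       = (LINT t:open_simplex n|PiM {..<n} (\<lambda>_. lborel).
            (\<Prod>i<n. p i (t i)) * volterra (p n) h (last_time n t))"
proof -
  interpret product_sigma_finite "\<lambda>_::nat. lborel::real measure" ..
  let ?f = "\<lambda>t. indicator (open_simplex (Suc n)) t *\<^sub>R
              ((\<Prod>i<Suc n. p i (t i)) * h (last_time (Suc n) t))"
  have [measurable]: "p i \<in> borel_measurable borel" if "i \<le> n" for i
    using p[OF that] by (simp add: bounded_on_unit_def)
  note h(1)[measurable]
  have pm: "(\<lambda>t. \<Prod>i<Suc n. p i (t i)) \<in> borel_measurable (PiM {..<Suc n} (\<lambda>_. lborel))"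
    by (intro borel_measurable_prod) (auto intro!: measurable_compose[OF measurable_component_singleton])
  have "integrable (PiM {..<Suc n} (\<lambda>_. lborel)) ?f"
  proof (rule Bochner_Integration.integrable_bound)
    show "integrable (PiM {..<Suc n} (\<lambda>_. lborel)) (\<lambda>t. (\<Prod>i\<in>{..<Suc n}. p i (t i)) * of_real C)"
      by (intro integrable_mult_left product_integrable_prod integrable_bounded_on_unit[OF p]) auto
    show "?f \<in> borel_measurable (PiM {..<Suc n} (\<lambda>_. lborel))"
      using pm by measurable
    show "AE t in PiM {..<Suc n} (\<lambda>_. lborel). norm (?f t) \<le> norm ((\<Prod>i\<in>{..<Suc n}. p i (t i)) * of_real C)"
    proof (rule AE_I2)
      fix t
      have "norm (?f t) \<le> norm (\<Prod>i<Suc n. p i (t i)) * norm (h (last_time (Suc n) t))"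
        by (simp add: norm_mult indicator_def)
      also have "\<dots> \<le> norm (\<Prod>i<Suc n. p i (t i)) * \<bar>C\<bar>"
        using h(2)[of "last_time (Suc n) t"] by (intro mult_left_mono) auto
      finally show "norm (?f t) \<le> norm ((\<Prod>i\<in>{..<Suc n}. p i (t i)) * of_real C)"
        by (simp add: norm_mult)
    qed
  qed
  then have "integral\<^sup>L (PiM {..<Suc n} (\<lambda>_. lborel)) ?f
      = (\<integral>t. (\<integral>y. ?f (t(n := y)) \<partial>lborel) \<partial>PiM {..<n} (\<lambda>_. lborel))"
    unfolding lessThan_Suc by (intro product_integral_insert) auto
  also have "\<dots> = (\<integral>t. indicator (open_simplex n) t *\<^sub>R
      ((\<Prod>i<n. p i (t i)) * volterra (p n) h (last_time n t)) \<partial>PiM {..<n} (\<lambda>_. lborel))"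
  proof (rule Bochner_Integration.integral_cong[OF refl])
    fix t :: "nat \<Rightarrow> real"
    have "?f (t(n := y)) = (indicator (open_simplex n) t *\<^sub>R (\<Prod>i<n. p i (t i))) *
        (indicator {0<..<last_time n t} y *\<^sub>R (p n y * h y))" for y
    proof -
      have "(\<Prod>i<n. p i (if i = n then y else t i)) = (\<Prod>i<n. p i (t i))"
        by (rule prod.cong) auto
      moreover have "last_time (Suc n) (t(n := y)) = y" by (simp add: last_time_def)
      ultimately show ?thesis by (auto simp: indicator_def open_simplex_Suc)
    qed
    then have "(\<integral>y. ?f (t(n := y)) \<partial>lborel) = (\<integral>y. (indicator (open_simplex n) t *\<^sub>R (\<Prod>i<n. p i (t i))) *
        (indicator {0<..<last_time n t} y *\<^sub>R (p n y * h y)) \<partial>lborel)"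
      by (rule Bochner_Integration.integral_cong[OF refl])
    also have "\<dots> = (indicator (open_simplex n) t *\<^sub>R (\<Prod>i<n. p i (t i))) *
        volterra (p n) h (last_time n t)"
      unfolding volterra_def set_lebesgue_integral_def by (rule integral_mult_right_zero)
    finally show "(\<integral>y. ?f (t(n := y)) \<partial>lborel) = indicator (open_simplex n) t *\<^sub>R
      ((\<Prod>i<n. p i (t i)) * volterra (p n) h (last_time n t))"
      by (simp only: mult_scaleR_left)
  qed
  finally show ?thesis by (simp only: set_lebesgue_integral_def)
qed

lemma volterra_measurable_bounded:
  assumes p: "bounded_on_unit B p" and h: "h \<in> borel_measurable borel" "\<And>s. norm (h s) \<le> C"
  shows "volterra p h \<in> borel_measurable borel" "norm (volterra p h x) \<le> B * C"
proof -
  have pm[measurable]: "p \<in> borel_measurable borel" and pb: "\<And>s. norm (p s) \<le> B * indicator {0<..<1} s"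
    using p by (auto simp: bounded_on_unit_def)
  note h(1)[measurable]
  have "volterra p h = (\<lambda>x. \<integral>s. (if 0 < s \<and> s < x then p s * h s else 0) \<partial>lborel)"
    by (auto simp: volterra_def set_lebesgue_integral_def fun_eq_iff indicator_def
        intro!: Bochner_Integration.integral_cong)
  also have "\<dots> \<in> borel_measurable borel" by measurable
  finally show "volterra p h \<in> borel_measurable borel" .
  have "norm (volterra p h x) \<le> (\<integral>s. norm (indicator {0<..<x} s *\<^sub>R (p s * h s)) \<partial>lborel)"
    unfolding volterra_def set_lebesgue_integral_def by (rule integral_norm_bound)
  also have "\<dots> \<le> (\<integral>s. (B * C) * indicator {0<..<1::real} s \<partial>lborel)"
  proof (rule integral_mono')
    show "integrable lborel (\<lambda>s. (B * C) * indicator {0<..<1::real} s)" by simp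
    fix s :: real
    have "norm (indicator {0<..<x} s *\<^sub>R (p s * h s)) \<le> norm (p s) * norm (h s)"
      by (simp add: indicator_def norm_mult)
    also have "\<dots> \<le> (B * indicator {0<..<1} s) * C"
      using pb[of s] h(2)[of s] by (intro mult_mono) (auto intro: order_trans[OF norm_ge_zero])
    finally show *: "norm (indicator {0<..<x} s *\<^sub>R (p s * h s)) \<le> (B * C) * indicator {0<..<1} s"
      by (simp add: mult_ac)
    show "0 \<le> (B * C) * indicator {0<..<1} s"
      using * by (rule order_trans[OF norm_ge_zero])
  qed
  also have "\<dots> = B * C" by simp
  finally show "norm (volterra p h x) \<le> B * C" .
qed

lemma open_simplex_integral_eq_foldr_volterra:
  fixes ps :: "(real \<Rightarrow> complex) list"
  assumes "\<And>p. p \<in> set ps \<Longrightarrow> bounded_on_unit B p"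
    and "h \<in> borel_measurable borel" "\<And>s. norm (h s) \<le> C"
  shows "(LINT t:open_simplex (length ps)|PiM {..<length ps} (\<lambda>_. lborel).
            (\<Prod>i<length ps. (ps ! i) (t i)) * h (last_time (length ps) t)) = foldr volterra ps h 1"
  using assms
proof (induction ps arbitrary: h C rule: rev_induct)
  case Nil
  have "open_simplex 0 = UNIV" by (auto simp: open_simplex_def)
  moreover have "PiM {} (\<lambda>_::nat. lborel::real measure) = count_space {\<lambda>_. undefined}"
    by (rule PiM_empty)
  ultimately show ?case
    by (simp add: set_lebesgue_integral_def last_time_def lebesgue_integral_count_space_finite)
next
  case (snoc p ps)
  let ?n = "length ps"
  have "(LINT t:open_simplex (Suc ?n)|PiM {..<Suc ?n} (\<lambda>_. lborel).
            (\<Prod>i<Suc ?n. ((ps @ [p]) ! i) (t i)) * h (last_time (Suc ?n) t))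
    = (LINT t:open_simplex ?n|PiM {..<?n} (\<lambda>_. lborel).
            (\<Prod>i<?n. ((ps @ [p]) ! i) (t i)) * volterra ((ps @ [p]) ! ?n) h (last_time ?n t))"
  proof (rule open_simplex_integral_Suc)
    fix i assume "i \<le> ?n"
    then have "(ps @ [p]) ! i \<in> set (ps @ [p])" by (intro nth_mem) simp
    then show "bounded_on_unit B ((ps @ [p]) ! i)" by (rule snoc.prems)
  qed (use snoc.prems in auto)
  also have "(\<lambda>t::nat \<Rightarrow> real. \<Prod>i<?n. ((ps @ [p]) ! i) (t i)) = (\<lambda>t. \<Prod>i<?n. (ps ! i) (t i))"
    by (auto simp: nth_append fun_eq_iff intro!: prod.cong)
  also have "volterra ((ps @ [p]) ! ?n) h = volterra p h" by simp
  also have "(LINT t:open_simplex ?n|PiM {..<?n} (\<lambda>_. lborel).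
            (\<Prod>i<?n. (ps ! i) (t i)) * volterra p h (last_time ?n t))
    = foldr volterra ps (volterra p h) 1"
    using snoc.prems volterra_measurable_bounded[of B p h C] by (intro snoc.IH) auto
  finally show ?case by simp
qed

lemma foldr_volterra_cong:
  assumes "\<And>F s. F \<in> set Fs \<Longrightarrow> s \<in> {0<..<1} \<Longrightarrow> P F s = Q F s" "x \<le> 1"
  shows "foldr volterra (map P Fs) h x = foldr volterra (map Q Fs) h x"
  using assms
proof (induction Fs arbitrary: x)
  case (Cons F Fs)
  have "P F s * foldr volterra (map P Fs) h s = Q F s * foldr volterra (map Q Fs) h s"
    if "s \<in> {0<..<x}" for s
    using Cons that by (metis greaterThanLessThan_iff less_eq_real_def list.set_intros order_less_le_trans)
  then have "volterra (P F) (foldr volterra (map P Fs) h) x = volterra (Q F) (foldr volterra (map Q Fs) h) x"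
    unfolding volterra_def[of "P F"] volterra_def[of "Q F"] by (intro set_lebesgue_integral_cong) auto
  then show ?case by simp
qed simp

text \<open>Cutting the integrands off outside the unit interval changes neither side: the simplex and the
  domains of the Volterra operators up to time \<open>1\<close> lie inside.\<close>
lemma iterated_integral_eq_foldr_volterra:
  assumes "\<And>F. F \<in> set Fs \<Longrightarrow> continuous_on {0<..<1} (path_pullback F)"
    and "\<And>F s. F \<in> set Fs \<Longrightarrow> s \<in> {0<..<1} \<Longrightarrow> norm (path_pullback F s) \<le> B"
  shows "iterated_integral Fs = foldr volterra (map path_pullback Fs) (\<lambda>_. 1) 1"
proof -
  define P where "P F s = indicator {0<..<1} s *\<^sub>R path_pullback F s" for F s
  have P: "bounded_on_unit B p" if "p \<in> set (map P Fs)" for p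
  proof -
    from that obtain F where F: "F \<in> set Fs" "p = P F" by auto
    have "P F \<in> borel_measurable borel"
      unfolding P_def by (rule borel_measurable_continuous_on_indicator[OF _ assms(1)[OF F(1)]]) simp
    then show ?thesis
      using F assms(2) by (auto simp: bounded_on_unit_def P_def indicator_def)
  qed
  have "iterated_integral Fs = (LINT t:open_simplex (length (map P Fs))|PiM {..<length (map P Fs)} (\<lambda>_. lborel).
            (\<Prod>i<length (map P Fs). (map P Fs ! i) (t i)) * 1)"
    unfolding iterated_integral_def set_lebesgue_integral_def length_map
  proof (intro Bochner_Integration.integral_cong refl)
    fix t
    show "indicator (open_simplex (length Fs)) t *\<^sub>R (\<Prod>i<length Fs. path_pullback (Fs ! i) (t i))
       = indicator (open_simplex (length Fs)) t *\<^sub>R ((\<Prod>i<length Fs. (map P Fs ! i) (t i)) * 1)"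
      by (auto simp: indicator_def open_simplex_def P_def intro!: prod.cong)
  qed
  also have "\<dots> = foldr volterra (map P Fs) (\<lambda>_. 1) 1"
    by (rule open_simplex_integral_eq_foldr_volterra[OF P]) auto
  also have "\<dots> = foldr volterra (map path_pullback Fs) (\<lambda>_. 1) 1"
    by (rule foldr_volterra_cong) (auto simp: P_def)
  finally show ?thesis .
qed

section \<open>Decay of forms of cusp modular type\<close>

lemma slash_mat_1: "slash k f (mat 1) z = f z"
  by (simp add: slash_def moebius_def mat_def)

lemma mat_1_in_SL2Z: "mat 1 \<in> carrier SL2Z"
  by (simp add: SL2Z_def det_I)

text \<open>The expansion at \<open>\<i>\<infinity>\<close> is a power series in \<open>q = exp (2 \<pi> \<i> z / N)\<close> without constant term, so it is
  \<open>q\<close> times a series that stays bounded on closed smaller discs.\<close>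
lemma cusp_form_exp_decay:
  assumes "cusp_form \<Gamma> k f"
  obtains C c where "c > 0" "C \<ge> 0" "\<And>z. Im z \<ge> 1 \<Longrightarrow> norm (f z) \<le> C * exp (- c * Im z)"
proof -
  from assms mat_1_in_SL2Z obtain N :: nat and a :: "nat \<Rightarrow> complex" where N: "N \<ge> 1" and a0: "a 0 = 0"
    and sums: "\<And>z. z \<in> upper_half_plane \<Longrightarrow>
      (\<lambda>n. a n * exp (2 * of_real pi * \<i> * of_nat n * z / of_nat N)) sums slash k f (mat 1) z"
    unfolding cusp_form_def by blast
  define q where "q z = exp (2 * of_real pi * \<i> * z / of_nat N)" for z :: complex
  define c where "c = 2 * pi / N"
  have c: "c > 0" using N by (simp add: c_def)
  have norm_q: "norm (q z) = exp (- c * Im z)" for z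
    by (simp add: q_def c_def)
  have q_sums: "(\<lambda>n. a n * q z ^ n) sums f z" if "Im z > 0" for z
  proof -
    have "exp (2 * of_real pi * \<i> * of_nat n * z / of_nat N) = q z ^ n" for n
      by (simp add: q_def mult_ac flip: exp_of_nat_mult)
    then show ?thesis using sums[of z] that by (simp add: upper_half_plane_def slash_mat_1)
  qed
  define r where "r = exp (- c)"
  have r: "r > 0" by (simp add: r_def)
  have "summable (\<lambda>n. norm (a n * of_real r ^ n))"
  proof (rule powser_insidea)
    \<comment> \<open>Convergence at the height \<open>1 / 2\<close> gives absolute convergence at the height \<open>1\<close>.\<close>
    show "summable (\<lambda>n. a n * q (\<i> / 2) ^ n)" using q_sums[of "\<i> / 2"] by (simp add: sums_iff)
    show "norm (of_real r :: complex) < norm (q (\<i> / 2))" using c by (simp add: norm_q r_def)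
  qed
  then have sm: "summable (\<lambda>n. norm (a n) * r ^ n)" using r by (simp add: norm_mult norm_power)
  define S where "S = (\<Sum>n. norm (a n) * r ^ n)"
  have "S \<ge> 0" unfolding S_def using r sm by (intro suminf_nonneg) auto
  show ?thesis
  proof (rule that[of c "S / r"])
    fix z :: complex assume z: "Im z \<ge> 1"
    have qr: "norm (q z) \<le> r" using z c by (simp add: norm_q r_def)
    have le: "norm (a n * q z ^ n) \<le> (norm (q z) / r) * (norm (a n) * r ^ n)" for n
    proof (cases n)
      case (Suc m)
      have "norm (q z) ^ m \<le> r ^ m" using qr by (intro power_mono) auto
      then have "norm (a n) * norm (q z) * norm (q z) ^ m \<le> norm (a n) * norm (q z) * r ^ m"
        by (intro mult_left_mono) auto
      then show ?thesis using r Suc by (simp add: norm_mult norm_power mult_ac)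
    qed (simp add: a0)
    have "norm (f z) = norm (\<Sum>n. a n * q z ^ n)" using q_sums[of z] z by (simp add: sums_iff)
    also have "\<dots> \<le> (\<Sum>n. (norm (q z) / r) * (norm (a n) * r ^ n))"
      using le sm by (intro norm_suminf_le summable_mult) auto
    also have "\<dots> = (norm (q z) / r) * S" unfolding S_def by (rule suminf_mult[OF sm])
    finally show "norm (f z) \<le> S / r * exp (- c * Im z)" by (simp add: norm_q mult_ac)
  qed (use c r \<open>S \<ge> 0\<close> in auto)
qed

lemma exp_minus_le_inverse_power:
  fixes c y :: real
  assumes "c > 0" "y > 0"
  shows "exp (- c * y) \<le> fact n / (c * y) ^ n"
proof -
  have "(\<Sum>i\<in>{n}. (c * y) ^ i /\<^sub>R fact i) \<le> exp (c * y)"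
    unfolding exp_def using assms summable_exp[of "c * y"]
    by (intro sum_le_suminf summable_exp_generic) auto
  then show ?thesis using assms by (simp add: exp_minus field_simps)
qed

text \<open>The argument is bounded, so in the strip \<open>z powr a\<close> grows at most polynomially in the height;
  exponential decay of a cusp form beats it.\<close>
lemma norm_powr_strip_le:
  assumes "Im z \<ge> 1" "\<bar>Re z\<bar> \<le> 1" "\<bar>Re a\<bar> \<le> of_nat m"
  shows "norm (z powr a) \<le> (2 * Im z) ^ m * exp (\<bar>Im a\<bar> * pi)"
proof -
  have "norm z \<le> \<bar>Re z\<bar> + \<bar>Im z\<bar>" by (rule cmod_le)
  then have le: "norm z \<le> 2 * Im z" using assms by linarith
  have ge: "norm z \<ge> 1" using abs_Im_le_cmod[of z] assms by linarith
  have "norm z powr Re a \<le> norm z powr m" using ge assms(3) by (intro powr_mono) auto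
  also have "\<dots> = norm z ^ m" using ge by (subst powr_realpow) auto
  also have "\<dots> \<le> (2 * Im z) ^ m" using le by (intro power_mono) auto
  finally have "norm z powr Re a \<le> (2 * Im z) ^ m" .
  moreover have "- Im a * Arg z \<le> \<bar>Im a\<bar> * pi"
  proof -
    have "\<bar>Arg z\<bar> \<le> pi" using Arg_bounded[of z] by auto
    then have "\<bar>Im a\<bar> * \<bar>Arg z\<bar> \<le> \<bar>Im a\<bar> * pi" by (intro mult_left_mono) auto
    moreover have "- Im a * Arg z \<le> \<bar>Im a\<bar> * \<bar>Arg z\<bar>"
      by (metis abs_ge_self abs_minus_cancel abs_mult)
    ultimately show ?thesis by linarith
  qed
  ultimately show ?thesis
    unfolding norm_powr_complex using assms by (intro mult_mono) auto
qed

text \<open>Inverse square decay is what the substitution \<open>y = t / (1 - t)\<close> consumes: \<open>dy = dt / (1 - t)\<^sup>2\<close>, so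
  that the form pulled back to the unit interval stays bounded as \<open>t\<close> tends to \<open>1\<close>.\<close>
lemma cusp_modular_type_decay:
  assumes "cusp_modular_type F"
  obtains C where "\<And>z. Im z \<ge> 1 \<Longrightarrow> \<bar>Re z\<bar> \<le> 1 \<Longrightarrow> norm (F z) \<le> C / (Im z)\<^sup>2"
proof -
  from assms obtain \<Gamma> k f s where f: "cusp_form \<Gamma> k f"
    and F: "\<And>z. z \<in> upper_half_plane \<Longrightarrow> F z = f z * z powr (s - 1)"
    unfolding cusp_modular_type_def by blast
  from cusp_form_exp_decay[OF f] obtain C c where C: "c > 0" "C \<ge> 0"
    "\<And>z. Im z \<ge> 1 \<Longrightarrow> norm (f z) \<le> C * exp (- c * Im z)" by metis
  obtain m :: nat where m: "\<bar>Re (s - 1)\<bar> \<le> of_nat m" using real_arch_simple by blast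
  define D where "D = C * (fact (m + 2) / c ^ (m + 2)) * (2 ^ m * exp (\<bar>Im (s - 1)\<bar> * pi))"
  show ?thesis
  proof (rule that[of D])
    fix z assume z: "Im z \<ge> 1" "\<bar>Re z\<bar> \<le> 1"
    have "norm (f z) \<le> C * (fact (m + 2) / (c * Im z) ^ (m + 2))"
      using C(3)[OF z(1)] exp_minus_le_inverse_power[OF C(1), of "Im z" "m + 2"] C(2) z
      by (meson dual_order.trans less_le_trans mult_left_mono zero_less_one)
    moreover have "norm (z powr (s - 1)) \<le> (2 * Im z) ^ m * exp (\<bar>Im (s - 1)\<bar> * pi)"
      by (rule norm_powr_strip_le[OF z m])
    ultimately have "norm (f z) * norm (z powr (s - 1)) \<le> C * (fact (m + 2) / (c * Im z) ^ (m + 2)) *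
        ((2 * Im z) ^ m * exp (\<bar>Im (s - 1)\<bar> * pi))"
      using z C by (intro mult_mono) auto
    then have "norm (F z) \<le> C * (fact (m + 2) / (c * Im z) ^ (m + 2)) *
        ((2 * Im z) ^ m * exp (\<bar>Im (s - 1)\<bar> * pi))"
      using F[of z] z by (simp only: upper_half_plane_def norm_mult mem_Collect_eq)
    also have "\<dots> = D / (Im z)\<^sup>2"
      using z C unfolding D_def power_mult_distrib power_add by (simp add: field_simps)
    finally show "norm (F z) \<le> D / (Im z)\<^sup>2" .
  qed
qed

lemma cusp_modular_type_holomorphic:
  assumes "cusp_modular_type F"
  shows "F holomorphic_on upper_half_plane"
proof -
  from assms obtain \<Gamma> k f s where f: "cusp_form \<Gamma> k f"
    and F: "\<And>z. z \<in> upper_half_plane \<Longrightarrow> F z = f z * z powr (s - 1)"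
    unfolding cusp_modular_type_def by blast
  have "(\<lambda>z. f z * z powr (s - 1)) holomorphic_on upper_half_plane"
    using f by (auto intro!: holomorphic_intros simp: cusp_form_def upper_half_plane_def complex_nonpos_Reals_iff)
  then show ?thesis by (rule holomorphic_transform) (simp add: F)
qed

section \<open>Iterated primitives on the upper half plane\<close>

lemma open_upper_half_plane: "open upper_half_plane"
  and convex_upper_half_plane: "convex upper_half_plane"
  unfolding upper_half_plane_def by (rule open_halfspace_Im_gt, rule convex_halfspace_Im_gt)

lemma has_vector_derivative_imag_geodesic:
  assumes "t < 1"
  shows "(imag_geodesic has_vector_derivative \<i> / of_real ((1 - t)\<^sup>2)) (at t)"
proof -
  have "((\<lambda>t. t / (1 - t)) has_real_derivative 1 / (1 - t)\<^sup>2) (at t)"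
    using assms by (auto intro!: derivative_eq_intros simp: power2_eq_square)
  then have "((\<lambda>t. t / (1 - t)) has_vector_derivative 1 / (1 - t)\<^sup>2) (at t)"
    by (simp add: has_real_derivative_iff_has_vector_derivative)
  then have "((\<lambda>t. of_real (t / (1 - t)) :: complex) has_vector_derivative of_real (1 / (1 - t)\<^sup>2)) (at t)"
    by (rule bounded_linear.has_vector_derivative[OF bounded_linear_of_real])
  then show ?thesis unfolding imag_geodesic_def[abs_def]
    by (rule has_vector_derivative_mult_right[THEN has_vector_derivative_eq_rhs]) simp
qed

lemma path_pullback_eq: "t < 1 \<Longrightarrow> path_pullback F t = F (imag_geodesic t) * (\<i> / of_real ((1 - t)\<^sup>2))"
  unfolding path_pullback_def
  by (simp only: vector_derivative_at[OF has_vector_derivative_imag_geodesic])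

lemma imag_geodesic_in: "t \<in> {0<..<1} \<Longrightarrow> imag_geodesic t \<in> upper_half_plane"
  by (simp add: imag_geodesic_def upper_half_plane_def)

lemma imag_geodesic_of_height: "y > 0 \<Longrightarrow> imag_geodesic (y / (1 + y)) = \<i> * of_real y"
proof -
  assume "y > 0"
  then have "(y / (1 + y)) / (1 - y / (1 + y)) = y" by (simp add: field_simps)
  then show ?thesis by (simp only: imag_geodesic_def)
qed

lemma continuous_on_imag_geodesic: "continuous_on {0<..<1} imag_geodesic"
  using has_vector_derivative_imag_geodesic
  by (intro continuous_at_imp_continuous_on ballI has_vector_derivative_continuous) auto

lemma continuous_on_path_pullback:
  assumes "F holomorphic_on upper_half_plane"
  shows "continuous_on {0<..<1} (path_pullback F)"
proof -
  have "continuous_on {0<..<1} (\<lambda>t. F (imag_geodesic t) * (\<i> / of_real ((1 - t)\<^sup>2)))"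
    using holomorphic_on_imp_continuous_on[OF assms] imag_geodesic_in
    by (intro continuous_intros continuous_on_compose2[OF _ continuous_on_imag_geodesic]) auto
  then show ?thesis
    by (rule continuous_on_eq) (simp add: path_pullback_eq)
qed

text \<open>A function with bounded derivative is Lipschitz, hence extends continuously to the endpoints,
  where the fundamental theorem of calculus then applies.\<close>
lemma bounded_derivative_endpoints:
  fixes F q :: "real \<Rightarrow> complex"
  assumes D: "\<And>t. t \<in> {0<..<1} \<Longrightarrow> (F has_vector_derivative q t) (at t)"
    and q: "continuous_on {0<..<1} q" "\<And>t. t \<in> {0<..<1} \<Longrightarrow> norm (q t) \<le> B"
  obtains a b where "(F \<longlongrightarrow> a) (at_right 0)" "(F \<longlongrightarrow> b) (at_left 1)" "bounded (F ` {0<..<1})"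
    "\<And>x. x \<in> {0<..<1} \<Longrightarrow> (LINT s:{0<..<x}|lborel. q s) = F x - a"
    "(LINT s:{0<..<1}|lborel. q s) = b - a"
proof -
  have B0: "B \<ge> 0" using q(2)[of "1/2"] order_trans[OF norm_ge_zero] by auto
  have lip: "norm (F x - F y) \<le> B * norm (x - y)" if "x \<in> {0<..<1}" "y \<in> {0<..<1}" for x y
  proof (rule differentiable_bound[where S = "{0<..<1}" and f' = "\<lambda>t h. h *\<^sub>R q t"])
    show "(F has_derivative (\<lambda>h. h *\<^sub>R q t)) (at t within {0<..<1})" if "t \<in> {0<..<1}" for t
      using D[OF that] by (simp add: has_vector_derivative_def has_derivative_at_withinI)
    show "onorm (\<lambda>h. h *\<^sub>R q t) \<le> B" if "t \<in> {0<..<1}" for t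
      using q(2)[OF that] by (intro onorm_le) (simp add: mult.commute[of B] mult_left_mono)
  qed (use that in auto)
  then have "B-lipschitz_on {0<..<1} F"
    using B0 by (intro lipschitz_onI) (auto simp: dist_norm)
  then have uc: "uniformly_continuous_on {0<..<1} F" by (rule lipschitz_on_uniformly_continuous)
  obtain a where a: "(F \<longlongrightarrow> a) (at_right 0)"
  proof -
    have "at_right 0 = at 0 within {0::real<..<1}" by (rule at_within_nhd[of _ "{..<1}"]) auto
    moreover have "(0::real) \<in> closure {0<..<1}" by simp
    ultimately show ?thesis
      using uniformly_continuous_on_extension_at_closure[OF uc] that by metis
  qed
  obtain b where b: "(F \<longlongrightarrow> b) (at_left 1)"
  proof -
    have "at_left 1 = at 1 within {0::real<..<1}" by (rule at_within_nhd[of _ "{0<..}"]) auto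
    moreover have "(1::real) \<in> closure {0<..<1}" by simp
    ultimately show ?thesis
      using uniformly_continuous_on_extension_at_closure[OF uc] that by metis
  qed
  have bd: "bounded (F ` {0<..<1})"
    by (rule bounded_uniformly_continuous_image[OF uc]) simp
  have ftc: "(LINT s:{0<..<x}|lborel. q s) = l - a" if x: "0 < x" "x \<le> 1" and l: "(F \<longlongrightarrow> l) (at_left x)" for x l
  proof -
    have sub: "{0<..<x} \<subseteq> {0<..<1}" using x by auto
    have "set_integrable lborel {0<..<x} q"
    proof (rule set_integrable_bound)
      show "set_integrable lborel {0<..<x} (\<lambda>_. B)"
        using x by (simp add: set_integrable_def)
      show "set_borel_measurable lborel {0<..<x} q"
        using borel_measurable_continuous_on_indicator[of "{0<..<x}" q] continuous_on_subset[OF q(1) sub]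
        by (simp add: set_borel_measurable_def)
      show "AE s in lborel. s \<in> {0<..<x} \<longrightarrow> norm (q s) \<le> norm B"
        using q(2) sub B0 by (intro AE_I2) auto
    qed
    moreover have "isCont q s" if "s \<in> {0<..<1}" for s
      using q(1) that by (simp add: continuous_on_eq_continuous_at)
    moreover have "((F \<circ> real_of_ereal) \<longlongrightarrow> a) (at_right (ereal 0))" "((F \<circ> real_of_ereal) \<longlongrightarrow> l) (at_left (ereal x))"
      using a l by (simp_all only: ereal_tendsto_simps)
    ultimately have "(LBINT s=ereal 0..ereal x. q s) = l - a"
      using x D by (intro interval_integral_FTC_integrable[where F = F]) (simp_all only: einterval_eq, auto)
    then show ?thesis using x by (subst (asm) interval_integral_Ioo) auto
  qed
  show ?thesis
  proof (rule that[OF a b bd])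
    fix x :: real assume x: "x \<in> {0<..<1}"
    have "isCont F x" using D[OF x] by (rule has_vector_derivative_continuous)
    then have "(F \<longlongrightarrow> F x) (at_left x)" unfolding isCont_def by (rule filterlim_mono) (auto simp: at_le)
    then show "(LINT s:{0<..<x}|lborel. q s) = F x - a" using x by (intro ftc) auto
  qed (rule ftc, use b in auto)
qed

text \<open>The analytic input of the argument: integrability along the imaginary axis, and enough decay
  towards \<open>\<i>\<infinity>\<close> for limits there not to depend on the vertical line in the strip \<open>\<bar>Re z\<bar> \<le> 1\<close>.\<close>
locale vanishing_forms =
  fixes V :: "'v set" and \<omega> :: "'v \<Rightarrow> one_form"
  assumes holomorphic: "v \<in> V \<Longrightarrow> \<omega> v holomorphic_on upper_half_plane"
    and decay: "v \<in> V \<Longrightarrow>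
      \<exists>C. \<forall>z. Im z \<ge> 1 \<longrightarrow> \<bar>Re z\<bar> \<le> 1 \<longrightarrow> norm (\<omega> v z) \<le> C / (Im z)\<^sup>2"
    and bounded_path: "v \<in> V \<Longrightarrow> \<exists>B. \<forall>t\<in>{0<..<1}. norm (path_pullback (\<omega> v) t) \<le> B"

text \<open>The iterated integral of the forms of a word along any path from \<open>0\<close> to \<open>z\<close> that leaves \<open>0\<close> along the
  imaginary axis. Homotopy invariance is built in by taking holomorphic primitives, which exist
  because the half plane is convex; the vanishing at \<open>0\<close> fixes the constant of integration.\<close>
primrec iterated_primitive :: "('v \<Rightarrow> one_form) \<Rightarrow> 'v list \<Rightarrow> complex \<Rightarrow> complex" where
  "iterated_primitive \<omega> [] = (\<lambda>_. 1)"
| "iterated_primitive \<omega> (v # w) = (SOME G.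
     (\<forall>z\<in>upper_half_plane. (G has_field_derivative \<omega> v z * iterated_primitive \<omega> w z) (at z)) \<and>
     ((\<lambda>t. G (imag_geodesic t)) \<longlongrightarrow> 0) (at_right 0))"

(* The choice operator must stay folded: the primitive is used only through its derivative and limit. *)
declare iterated_primitive.simps(2) [simp del]

context vanishing_forms
begin

text \<open>What a factor has to satisfy for its product with one more form to be integrable down to \<open>0\<close>.\<close>
definition "tame L \<longleftrightarrow> L holomorphic_on upper_half_plane \<and> bounded ((\<lambda>t. L (imag_geodesic t)) ` {0<..<1})"

text \<open>Along the imaginary axis \<open>G\<close> has a bounded derivative in the path parameter, so it has limits at
  both ends and its increments are values of the Volterra operator. In particular \<open>G\<close> is again tame,
  which drives the recursion.\<close>
lemma primitive_endpoints:
  assumes v: "v \<in> V" and L: "tame L"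
    and G: "\<And>z. z \<in> upper_half_plane \<Longrightarrow> (G has_field_derivative \<omega> v z * L z) (at z)"
  obtains a b where "((\<lambda>t. G (imag_geodesic t)) \<longlongrightarrow> a) (at_right 0)"
    "((\<lambda>t. G (imag_geodesic t)) \<longlongrightarrow> b) (at_left 1)" "tame G"
    "\<And>x. x \<in> {0<..<1} \<Longrightarrow>
      volterra (path_pullback (\<omega> v)) (\<lambda>t. L (imag_geodesic t)) x = G (imag_geodesic x) - a"
    "volterra (path_pullback (\<omega> v)) (\<lambda>t. L (imag_geodesic t)) 1 = b - a"
proof -
  define q where "q t = path_pullback (\<omega> v) t * L (imag_geodesic t)" for t
  have Lh: "L holomorphic_on upper_half_plane" using L by (simp add: tame_def)
  obtain K where K: "\<And>t. t \<in> {0<..<1} \<Longrightarrow> norm (L (imag_geodesic t)) \<le> K"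
    using L unfolding tame_def bounded_iff by blast
  obtain B where B: "\<And>t. t \<in> {0<..<1} \<Longrightarrow> norm (path_pullback (\<omega> v) t) \<le> B"
    using bounded_path[OF v] by blast
  have D: "((\<lambda>t. G (imag_geodesic t)) has_vector_derivative q t) (at t)" if t: "t \<in> {0<..<1}" for t
  proof -
    have "(G \<circ> imag_geodesic has_vector_derivative
        (\<i> / of_real ((1 - t)\<^sup>2)) * (\<omega> v (imag_geodesic t) * L (imag_geodesic t))) (at t)"
      using t by (intro field_vector_diff_chain_at has_vector_derivative_imag_geodesic G imag_geodesic_in) auto
    then show ?thesis using t by (simp add: q_def path_pullback_eq o_def mult_ac)
  qed
  have cont: "continuous_on {0<..<1} q"
    unfolding q_def using imag_geodesic_in
    by (intro continuous_intros continuous_on_path_pullback holomorphic[OF v]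
        continuous_on_compose2[OF holomorphic_on_imp_continuous_on[OF Lh] continuous_on_imag_geodesic]) auto
  have bnd: "norm (q t) \<le> B * K" if t: "t \<in> {0<..<1}" for t
    unfolding q_def norm_mult using K[OF t] B[OF t] order_trans[OF norm_ge_zero B[OF t]]
    by (intro mult_mono) auto
  have "G holomorphic_on upper_half_plane"
    using G by (auto simp: holomorphic_on_open[OF open_upper_half_plane])
  then have tame: "bounded ((\<lambda>t. G (imag_geodesic t)) ` {0<..<1}) \<Longrightarrow> tame G" by (simp add: tame_def)
  have volt: "volterra (path_pullback (\<omega> v)) (\<lambda>t. L (imag_geodesic t)) x = (LINT s:{0<..<x}|lborel. q s)" for x
    by (simp add: volterra_def q_def)
  show ?thesis
    by (rule bounded_derivative_endpoints[OF D cont bnd]; (assumption | rule that))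
      (simp_all add: volt tame)
qed

lemma primitive_exists:
  assumes v: "v \<in> V" and L: "tame L"
  shows "\<exists>G. (\<forall>z\<in>upper_half_plane. (G has_field_derivative \<omega> v z * L z) (at z)) \<and>
     ((\<lambda>t. G (imag_geodesic t)) \<longlongrightarrow> 0) (at_right 0)"
proof -
  have "(\<lambda>z. \<omega> v z * L z) holomorphic_on upper_half_plane"
    using holomorphic[OF v] L by (auto intro!: holomorphic_intros simp: tame_def)
  then obtain G where "\<And>z. z \<in> upper_half_plane \<Longrightarrow> (G has_field_derivative \<omega> v z * L z) (at z within upper_half_plane)"
    using holomorphic_convex_primitive'[OF convex_upper_half_plane open_upper_half_plane] by metis
  then have G: "\<And>z. z \<in> upper_half_plane \<Longrightarrow> (G has_field_derivative \<omega> v z * L z) (at z)"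
    by (simp add: at_within_open[OF _ open_upper_half_plane])
  obtain a where a: "((\<lambda>t. G (imag_geodesic t)) \<longlongrightarrow> a) (at_right 0)"
    by (rule primitive_endpoints[OF v L G]; (assumption | (rule that, assumption)))
  have "((\<lambda>t. G (imag_geodesic t) - a) \<longlongrightarrow> 0) (at_right 0)"
    using tendsto_diff[OF a tendsto_const[of a]] by simp
  moreover have "((\<lambda>z. G z - a) has_field_derivative \<omega> v z * L z) (at z)" if "z \<in> upper_half_plane" for z
    using G[OF that] by (auto intro!: derivative_eq_intros)
  ultimately show ?thesis by (intro exI[of _ "\<lambda>z. G z - a"]) auto
qed

lemma iterated_primitive_Cons:
  assumes "v \<in> V" "tame (iterated_primitive \<omega> w)"
  shows "z \<in> upper_half_plane \<Longrightarrow>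
      (iterated_primitive \<omega> (v # w) has_field_derivative \<omega> v z * iterated_primitive \<omega> w z) (at z)"
    and "((\<lambda>t. iterated_primitive \<omega> (v # w) (imag_geodesic t)) \<longlongrightarrow> 0) (at_right 0)"
  using someI_ex[OF primitive_exists[OF assms]] by (simp_all add: iterated_primitive.simps(2))

text \<open>Both sides satisfy the same recursion: on the axis, the primitive vanishing at \<open>0\<close> is the
  Volterra transform.\<close>
lemma iterated_primitive_volterra:
  assumes "set w \<subseteq> V"
  defines "K \<equiv> foldr volterra (map path_pullback (map \<omega> w)) (\<lambda>_. 1)"
  shows "tame (iterated_primitive \<omega> w) \<and>
    ((\<lambda>t. iterated_primitive \<omega> w (imag_geodesic t)) \<longlongrightarrow> (if w = [] then 1 else 0)) (at_right 0) \<and>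
    ((\<lambda>t. iterated_primitive \<omega> w (imag_geodesic t)) \<longlongrightarrow> K 1) (at_left 1) \<and>
    (\<forall>x\<in>{0<..<1}. K x = iterated_primitive \<omega> w (imag_geodesic x))"
  unfolding K_def using assms(1)
proof (induction w)
  case Nil
  have "tame (\<lambda>_. 1)" by (auto simp: tame_def image_constant_conv)
  then show ?case by simp
next
  case (Cons v w)
  let ?K = "foldr volterra (map path_pullback (map \<omega> w)) (\<lambda>_. 1)"
  let ?L = "iterated_primitive \<omega> w" and ?G = "iterated_primitive \<omega> (v # w)"
  from Cons have v: "v \<in> V" and L: "tame ?L"
    and K: "\<And>x. x \<in> {0<..<1} \<Longrightarrow> ?K x = ?L (imag_geodesic x)" by auto
  note G = iterated_primitive_Cons[OF v L]
  obtain a b where ab: "((\<lambda>t. ?G (imag_geodesic t)) \<longlongrightarrow> a) (at_right 0)"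
    "((\<lambda>t. ?G (imag_geodesic t)) \<longlongrightarrow> b) (at_left 1)" "tame ?G"
    "\<And>x. x \<in> {0<..<1} \<Longrightarrow>
      volterra (path_pullback (\<omega> v)) (\<lambda>t. ?L (imag_geodesic t)) x = ?G (imag_geodesic x) - a"
    "volterra (path_pullback (\<omega> v)) (\<lambda>t. ?L (imag_geodesic t)) 1 = b - a"
    by (rule primitive_endpoints[OF v L G(1)]; (assumption | (rule that; assumption)))
  have "a = 0" using tendsto_unique[OF _ ab(1) G(2)] by simp
  have KL: "volterra (path_pullback (\<omega> v)) ?K x
      = volterra (path_pullback (\<omega> v)) (\<lambda>t. ?L (imag_geodesic t)) x" if "x \<le> 1" for x
    using that by (intro volterra_cong K) auto
  have "volterra (path_pullback (\<omega> v)) ?K x = ?G (imag_geodesic x)" if "x \<in> {0<..<1}" for x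
    using KL[of x] ab(4)[OF that] that \<open>a = 0\<close> by auto
  moreover have "volterra (path_pullback (\<omega> v)) ?K 1 = b"
    using KL[of 1] ab(5) \<open>a = 0\<close> by simp
  ultimately show ?case
    unfolding list.map foldr_Cons o_apply using ab(2,3) G(2) by auto
qed

lemma iterated_integral_eq_volterra:
  assumes "set w \<subseteq> V"
  shows "iterated_integral (map \<omega> w) = foldr volterra (map path_pullback (map \<omega> w)) (\<lambda>_. 1) 1"
proof -
  have "\<exists>B. \<forall>v\<in>set w. \<forall>t\<in>{0<..<1}. norm (path_pullback (\<omega> v) t) \<le> B"
    using assms
  proof (induction w)
    case (Cons v w)
    then obtain B where B: "\<forall>v\<in>set w. \<forall>t\<in>{0<..<1}. norm (path_pullback (\<omega> v) t) \<le> B" by auto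
    obtain B' where B': "\<forall>t\<in>{0<..<1}. norm (path_pullback (\<omega> v) t) \<le> B'"
      using Cons.prems bounded_path[of v] by auto
    show ?case using B B' by (intro exI[of _ "max B B'"]) (auto simp: le_max_iff_disj)
  qed auto
  then obtain B where B: "\<forall>v\<in>set w. \<forall>t\<in>{0<..<1}. norm (path_pullback (\<omega> v) t) \<le> B" by blast
  show ?thesis
    by (rule iterated_integral_eq_foldr_volterra[where B = B])
      (use assms B in \<open>auto intro!: continuous_on_path_pullback holomorphic\<close>)
qed

lemma tame_iterated_primitive: "set w \<subseteq> V \<Longrightarrow> tame (iterated_primitive \<omega> w)"
  using iterated_primitive_volterra by blast

lemmas has_field_derivative_iterated_primitive =
  iterated_primitive_Cons(1)[OF _ tame_iterated_primitive]

text \<open>In terms of the height \<open>y = t / (1 - t)\<close> the two ends of the path are \<open>y = 0\<close> and \<open>y = \<infinity>\<close>.\<close>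
lemma iterated_primitive_at_0:
  assumes "set w \<subseteq> V"
  shows "((\<lambda>y. iterated_primitive \<omega> w (\<i> * of_real y)) \<longlongrightarrow> (if w = [] then 1 else 0)) (at_right 0)"
proof -
  have "filterlim (\<lambda>y::real. y / (1 + y)) (at_right 0) (at_right 0)" by real_asymp
  from filterlim_compose[OF _ this] iterated_primitive_volterra[OF assms]
  have "((\<lambda>y. iterated_primitive \<omega> w (imag_geodesic (y / (1 + y)))) \<longlongrightarrow> (if w = [] then 1 else 0)) (at_right 0)"
    by blast
  then show ?thesis
    by (rule Lim_transform_eventually)
      (auto simp: eventually_at_right_less imag_geodesic_of_height intro!: eventually_mono[OF eventually_at_right_less])
qed

lemma iterated_primitive_at_top:
  assumes "set w \<subseteq> V"
  shows "((\<lambda>y. iterated_primitive \<omega> w (\<i> * of_real y)) \<longlongrightarrow> iterated_integral (map \<omega> w)) at_top"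
proof -
  have "filterlim (\<lambda>y::real. y / (1 + y)) (at_left 1) at_top" by real_asymp
  from filterlim_compose[OF _ this] iterated_primitive_volterra[OF assms]
  have "((\<lambda>y. iterated_primitive \<omega> w (imag_geodesic (y / (1 + y)))) \<longlongrightarrow> iterated_integral (map \<omega> w)) at_top"
    unfolding iterated_integral_eq_volterra[OF assms] by blast
  then show ?thesis
    by (rule Lim_transform_eventually)
      (auto simp: imag_geodesic_of_height intro!: eventually_mono[OF eventually_gt_at_top[of 0]])
qed

text \<open>Integrate the derivative over a horizontal segment of length at most \<open>1\<close>: the form
  contributes its decay and the shorter word stays bounded.\<close>
lemma iterated_primitive_near_imag_axis:
  assumes "v \<in> V" "set w \<subseteq> V"
    and "\<exists>K. \<forall>z. Im z \<ge> 1 \<longrightarrow> \<bar>Re z\<bar> \<le> 1 \<longrightarrow> norm (iterated_primitive \<omega> w z) \<le> K"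
  shows "\<exists>C. \<forall>z. Im z \<ge> 1 \<longrightarrow> \<bar>Re z\<bar> \<le> 1 \<longrightarrow>
      norm (iterated_primitive \<omega> (v # w) z - iterated_primitive \<omega> (v # w) (\<i> * of_real (Im z))) \<le> C / (Im z)\<^sup>2"
proof -
  obtain C where C: "\<And>z. Im z \<ge> 1 \<Longrightarrow> \<bar>Re z\<bar> \<le> 1 \<Longrightarrow> norm (\<omega> v z) \<le> C / (Im z)\<^sup>2"
    using decay[OF assms(1)] by blast
  obtain K where K: "\<And>z. Im z \<ge> 1 \<Longrightarrow> \<bar>Re z\<bar> \<le> 1 \<Longrightarrow> norm (iterated_primitive \<omega> w z) \<le> K"
    using assms(3) by blast
  have "C \<ge> 0" using order_trans[OF norm_ge_zero C[of \<i>]] by simp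
  have "K \<ge> 0" using order_trans[OF norm_ge_zero K[of \<i>]] by simp
  show ?thesis
  proof (intro exI[of _ "C * K"] allI impI)
    fix z assume z: "Im z \<ge> 1" "\<bar>Re z\<bar> \<le> 1"
    let ?c = "\<i> * of_real (Im z)"
    \<comment> \<open>A horizontal segment, written as an intersection of half planes to make its convexity evident.\<close>
    define S where "S = {u. Im u \<ge> Im z} \<inter> {u. Im u \<le> Im z} \<inter> {u. Re u \<ge> - 1} \<inter> {u. Re u \<le> 1}"
    have S: "u \<in> S \<longleftrightarrow> Im u = Im z \<and> \<bar>Re u\<bar> \<le> 1" for u
      unfolding S_def by (simp, linarith)
    have "convex S"
      unfolding S_def by (intro convex_Int convex_halfspace_Im_ge convex_halfspace_Im_le
          convex_halfspace_Re_ge convex_halfspace_Re_le)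
    moreover have "(iterated_primitive \<omega> (v # w) has_field_derivative \<omega> v u * iterated_primitive \<omega> w u)
        (at u within S)" if "u \<in> S" for u
    proof -
      have "u \<in> upper_half_plane" using that z unfolding S upper_half_plane_def by simp
      then show ?thesis
        by (rule has_field_derivative_at_within[OF has_field_derivative_iterated_primitive[OF assms(1,2)]])
    qed
    moreover have "norm (\<omega> v u * iterated_primitive \<omega> w u) \<le> C / (Im z)\<^sup>2 * K" if "u \<in> S" for u
    proof -
      have u: "Im u = Im z" "\<bar>Re u\<bar> \<le> 1" using that S by auto
      have "norm (\<omega> v u) \<le> C / (Im z)\<^sup>2" "norm (iterated_primitive \<omega> w u) \<le> K"
        using C[of u] K[of u] u z by simp_all
      then show ?thesis unfolding norm_mult using \<open>C \<ge> 0\<close> by (intro mult_mono) simp_all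
    qed
    moreover have "z \<in> S" "?c \<in> S" using z unfolding S by simp_all
    ultimately have "norm (iterated_primitive \<omega> (v # w) z - iterated_primitive \<omega> (v # w) ?c)
        \<le> (C / (Im z)\<^sup>2 * K) * norm (z - ?c)"
      by (rule field_differentiable_bound)
    also have "\<dots> \<le> (C / (Im z)\<^sup>2 * K) * 1"
    proof (rule mult_left_mono)
      have "z - ?c = of_real (Re z)" by (simp add: complex_eq_iff)
      then show "norm (z - ?c) \<le> 1" using z by simp
    qed (use \<open>C \<ge> 0\<close> \<open>K \<ge> 0\<close> in auto)
    finally show "norm (iterated_primitive \<omega> (v # w) z - iterated_primitive \<omega> (v # w) ?c) \<le> C * K / (Im z)\<^sup>2"
      by simp
  qed
qed

lemma iterated_primitive_bounded_strip:
  assumes "set w \<subseteq> V"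
  shows "\<exists>K. \<forall>z. Im z \<ge> 1 \<longrightarrow> \<bar>Re z\<bar> \<le> 1 \<longrightarrow> norm (iterated_primitive \<omega> w z) \<le> K"
  using assms
proof (induction w)
  case (Cons v w)
  let ?G = "iterated_primitive \<omega> (v # w)"
  from Cons have v: "v \<in> V" "set w \<subseteq> V" by auto
  obtain C where C: "\<And>z. Im z \<ge> 1 \<Longrightarrow> \<bar>Re z\<bar> \<le> 1 \<Longrightarrow>
      norm (?G z - ?G (\<i> * of_real (Im z))) \<le> C / (Im z)\<^sup>2"
    using iterated_primitive_near_imag_axis[OF v Cons.IH[OF v(2)]] by blast
  have "C \<ge> 0" using order_trans[OF norm_ge_zero C[of \<i>]] by simp
  obtain B where B: "\<And>t. t \<in> {0<..<1} \<Longrightarrow> norm (?G (imag_geodesic t)) \<le> B"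
    using tame_iterated_primitive[OF Cons.prems] unfolding tame_def bounded_iff by blast
  show ?case
  proof (intro exI allI impI)
    fix z assume z: "Im z \<ge> 1" "\<bar>Re z\<bar> \<le> 1"
    have "norm (?G (\<i> * of_real (Im z))) \<le> B"
      using B[of "Im z / (1 + Im z)"] z by (simp add: imag_geodesic_of_height)
    moreover have "C / (Im z)\<^sup>2 \<le> C"
      using \<open>C \<ge> 0\<close> z by (simp add: divide_le_eq mult_le_cancel_left1)
    moreover have "norm (?G z) \<le> norm (?G z - ?G (\<i> * of_real (Im z))) + norm (?G (\<i> * of_real (Im z)))"
      by (metis diff_add_cancel norm_triangle_ineq)
    ultimately show "norm (?G z) \<le> C + B" using C[OF z] by linarith
  qed
qed auto

text \<open>The difference to the imaginary axis is of the order of the inverse square of the height.\<close>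
lemma iterated_primitive_at_top_strip:
  assumes "set w \<subseteq> V" "\<bar>x\<bar> \<le> 1"
  shows "((\<lambda>y. iterated_primitive \<omega> w (\<i> * of_real y + of_real x)) \<longlongrightarrow> iterated_integral (map \<omega> w)) at_top"
proof (cases w)
  case Nil
  then show ?thesis using iterated_primitive_at_top[of "[]"] by simp
next
  case (Cons v w')
  then have v: "v \<in> V" "set w' \<subseteq> V" using assms by auto
  let ?G = "iterated_primitive \<omega> (v # w')"
  obtain C where C: "\<And>z. Im z \<ge> 1 \<Longrightarrow> \<bar>Re z\<bar> \<le> 1 \<Longrightarrow>
      norm (?G z - ?G (\<i> * of_real (Im z))) \<le> C / (Im z)\<^sup>2"
    using iterated_primitive_near_imag_axis[OF v iterated_primitive_bounded_strip[OF v(2)]] by blast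
  have "((\<lambda>y. ?G (\<i> * of_real y + of_real x) - ?G (\<i> * of_real y)) \<longlongrightarrow> 0) at_top"
  proof (rule Lim_null_comparison)
    show "\<forall>\<^sub>F y in at_top. norm (?G (\<i> * of_real y + of_real x) - ?G (\<i> * of_real y)) \<le> C / y\<^sup>2"
      using eventually_ge_at_top[of 1]
    proof eventually_elim
      case (elim y)
      then show ?case using C[of "\<i> * of_real y + of_real x"] assms(2) by (simp)
    qed
    show "((\<lambda>y. C / y\<^sup>2) \<longlongrightarrow> 0) at_top" by real_asymp
  qed
  from tendsto_add[OF this iterated_primitive_at_top[OF assms(1)[unfolded Cons]]]
  show ?thesis by (simp add: Cons)
qed

end

section \<open>The modular transformations\<close>

lemma moebius_sigma: "moebius sigma_mat z = - 1 / z"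
  and moebius_tau: "moebius tau_mat z = (z - 1) / z"
  by (simp_all add: moebius_def sigma_mat_def tau_mat_def)

lemma has_field_derivative_moebius_sigma:
  "z \<noteq> 0 \<Longrightarrow> (moebius sigma_mat has_field_derivative 1 / z\<^sup>2) (at z)"
  unfolding moebius_sigma[abs_def] by (auto intro!: derivative_eq_intros simp: power2_eq_square)

lemma moebius_sigma_in: "z \<in> upper_half_plane \<Longrightarrow> moebius sigma_mat z \<in> upper_half_plane"
  unfolding moebius_sigma upper_half_plane_def by (auto simp: Im_divide sum_power2_gt_zero_iff)

lemma moebius_tau_in: "z \<in> upper_half_plane \<Longrightarrow> moebius tau_mat z \<in> upper_half_plane"
  unfolding moebius_tau upper_half_plane_def by (auto simp: Im_divide sum_power2_gt_zero_iff algebra_simps)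

text \<open>Boundedness near \<open>0\<close> is obtained from the decay of the forms at \<open>\<i>\<infinity>\<close>: \<open>\<sigma>\<close>
  exchanges the two ends of the imaginary axis, and the span of the forms is stable under it.\<close>
lemma vanishing_forms_cusp_modular_type:
  assumes cusp: "\<forall>v\<in>V. cusp_modular_type (\<omega> v)"
    and S: "pullback_matrix sigma_mat V \<omega> S"
  shows "vanishing_forms V \<omega>"
proof
  show "\<omega> v holomorphic_on upper_half_plane" if "v \<in> V" for v
    using cusp that cusp_modular_type_holomorphic by blast
  show decay: "\<exists>C. \<forall>z. Im z \<ge> 1 \<longrightarrow> \<bar>Re z\<bar> \<le> 1 \<longrightarrow> norm (\<omega> v z) \<le> C / (Im z)\<^sup>2" if "v \<in> V" for v
    using cusp_modular_type_decay cusp that by metis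
  then obtain C where C: "\<And>v z. v \<in> V \<Longrightarrow> Im z \<ge> 1 \<Longrightarrow> \<bar>Re z\<bar> \<le> 1 \<Longrightarrow> norm (\<omega> v z) \<le> C v / (Im z)\<^sup>2"
    by metis
  fix v assume v: "v \<in> V"
  define D where "D = (\<Sum>u\<in>V. norm (S v u) * C u)"
  have near_0: "norm (\<omega> v (\<i> * of_real y)) \<le> D" if y: "0 < y" "y \<le> 1" for y :: real
  proof -
    \<comment> \<open>\<open>\<sigma>\<close> maps this point high up on the axis to \<open>\<i> y\<close>.\<close>
    define z where "z = \<i> * of_real (1 / y)"
    have z: "Im z = 1 / y" "Re z = 0" "norm z = 1 / y" "z \<noteq> 0" "z \<in> upper_half_plane" "moebius sigma_mat z = \<i> * of_real y"
      using y by (auto simp: z_def norm_mult norm_divide upper_half_plane_def moebius_sigma field_simps)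
    have "\<omega> v (\<i> * of_real y) * (1 / z\<^sup>2) = (\<Sum>u\<in>V. S v u * \<omega> u z)"
      using S[unfolded pullback_matrix_def, rule_format, OF v z(5)]
      by (simp only: pullback_def z(6) DERIV_imp_deriv[OF has_field_derivative_moebius_sigma[OF z(4)]])
    then have "\<omega> v (\<i> * of_real y) = (\<Sum>u\<in>V. S v u * \<omega> u z) * z\<^sup>2"
      using z(4) by (simp add: field_simps)
    then have "norm (\<omega> v (\<i> * of_real y)) = norm (\<Sum>u\<in>V. S v u * \<omega> u z) * (1 / y\<^sup>2)"
      using z(3) by (simp add: norm_mult norm_power power_divide)
    also have "\<dots> \<le> (\<Sum>u\<in>V. norm (S v u) * (C u * y\<^sup>2)) * (1 / y\<^sup>2)"
    proof (intro mult_right_mono sum_norm_le)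
      fix u assume "u \<in> V"
      then have "norm (\<omega> u z) \<le> C u * y\<^sup>2" using C[of u z] z y by (simp add: power_divide)
      then show "norm (S v u * \<omega> u z) \<le> norm (S v u) * (C u * y\<^sup>2)"
        unfolding norm_mult by (rule mult_left_mono) simp
    qed simp
    also have "(\<Sum>u\<in>V. norm (S v u) * (C u * y\<^sup>2)) = D * y\<^sup>2"
      by (simp add: D_def sum_distrib_right mult.assoc)
    finally show ?thesis using y by simp
  qed
  show "\<exists>B. \<forall>t\<in>{0<..<1}. norm (path_pullback (\<omega> v) t) \<le> B"
  proof (intro exI ballI)
    fix t :: real assume t: "t \<in> {0<..<1}"
    define y where "y = t / (1 - t)"
    have norm_eq: "norm (path_pullback (\<omega> v) t) = norm (\<omega> v (\<i> * of_real y)) / (1 - t)\<^sup>2"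
      using t norm_of_real[of "1 - t", where 'a = complex]
      by (simp add: path_pullback_eq imag_geodesic_def y_def norm_mult norm_divide norm_power)
    show "norm (path_pullback (\<omega> v) t) \<le> 4 * \<bar>C v\<bar> + 4 * \<bar>D\<bar>"
    proof (cases "t < 1 / 2")
      case True
      then have "norm (\<omega> v (\<i> * of_real y)) \<le> D"
        using t by (intro near_0) (simp_all add: y_def)
      moreover have "(1 / 2)\<^sup>2 \<le> (1 - t)\<^sup>2" using True by (intro power_mono) auto
      then have "1 / (1 - t)\<^sup>2 \<le> 4" using t by (simp add: field_simps power2_eq_square)
      ultimately have "norm (\<omega> v (\<i> * of_real y)) * (1 / (1 - t)\<^sup>2) \<le> \<bar>D\<bar> * 4"
        by (intro mult_mono) auto
      then show ?thesis unfolding norm_eq by simp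
    next
      case False
      then have "norm (\<omega> v (\<i> * of_real y)) \<le> C v / y\<^sup>2"
        using t C[OF v, of "\<i> * of_real y"] by (simp add: y_def)
      then have "norm (path_pullback (\<omega> v) t) \<le> C v / y\<^sup>2 / (1 - t)\<^sup>2"
        unfolding norm_eq by (rule divide_right_mono) simp
      also have "\<dots> = C v * (1 / t\<^sup>2)" using t by (simp add: y_def power_divide)
      also have "\<dots> \<le> \<bar>C v\<bar> * 4"
      proof (rule mult_mono)
        have "(1 / 2)\<^sup>2 \<le> t\<^sup>2" using False by (intro power_mono) auto
        then show "1 / t\<^sup>2 \<le> 4" using t by (simp add: field_simps power2_eq_square)
      qed auto
      finally show ?thesis by simp
    qed
  qed
qed

section \<open>Horizontal series\<close>

text \<open>Coefficientwise form of the differential equation \<open>dX = (\<Sum>v\<in>V. A\<^sub>v \<eta>\<^sub>v) X\<close>.\<close>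
definition horizontal :: "'v set \<Rightarrow> ('v \<Rightarrow> one_form) \<Rightarrow> (complex \<Rightarrow> 'v ncps) \<Rightarrow> bool" where
  "horizontal V \<eta> X \<longleftrightarrow> (\<forall>z\<in>upper_half_plane. X z \<in> ncps_on V) \<and>
     (\<forall>z\<in>upper_half_plane. ((\<lambda>z. nc_coeff (X z) []) has_field_derivative 0) (at z)) \<and>
     (\<forall>z\<in>upper_half_plane. \<forall>v\<in>V. \<forall>w. set w \<subseteq> V \<longrightarrow>
       ((\<lambda>z. nc_coeff (X z) (v # w)) has_field_derivative \<eta> v z * nc_coeff (X z) w) (at z))"

text \<open>Convergence of each coefficient for the usual topology of the complex numbers. The topology of
  series declared as a class instance is finer and would ask for coefficients that are eventually constant.\<close>
definition coeff_tendsto :: "('a \<Rightarrow> 'v ncps) \<Rightarrow> 'v ncps \<Rightarrow> 'a filter \<Rightarrow> bool" where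
  "coeff_tendsto X L F \<longleftrightarrow> (\<forall>w. ((\<lambda>x. nc_coeff (X x) w) \<longlongrightarrow> nc_coeff L w) F)"

lemma coeff_tendsto_const: "coeff_tendsto (\<lambda>_. L) L F"
  by (simp add: coeff_tendsto_def)

lemma coeff_tendsto_mult:
  "coeff_tendsto X K F \<Longrightarrow> coeff_tendsto Y L F \<Longrightarrow> coeff_tendsto (\<lambda>x. X x * Y x) (K * L) F"
  unfolding coeff_tendsto_def nc_coeff_mult by (intro allI tendsto_sum tendsto_mult) auto

lemma coeff_tendsto_linear_subst:
  "coeff_tendsto X L F \<Longrightarrow> coeff_tendsto (\<lambda>x. linear_subst V M (X x)) (linear_subst V M L) F"
  unfolding coeff_tendsto_def nc_coeff_linear_subst by (auto intro!: tendsto_sum tendsto_mult)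

lemma coeff_tendsto_compose:
  "coeff_tendsto X L G \<Longrightarrow> filterlim g G F \<Longrightarrow> coeff_tendsto (\<lambda>x. X (g x)) L F"
  unfolding coeff_tendsto_def by (auto intro: filterlim_compose[where g = "\<lambda>x. nc_coeff (X x) w" for w])

lemma coeff_tendsto_eventually_eq:
  assumes "coeff_tendsto X L F" "\<forall>\<^sub>F x in F. X x = Y x"
  shows "coeff_tendsto Y L F"
  unfolding coeff_tendsto_def
proof
  fix w
  have "((\<lambda>x. nc_coeff (X x) w) \<longlongrightarrow> nc_coeff L w) F"
    using assms(1) by (simp add: coeff_tendsto_def)
  then show "((\<lambda>x. nc_coeff (Y x) w) \<longlongrightarrow> nc_coeff L w) F"
    by (rule Lim_transform_eventually) (use assms(2) in \<open>auto elim: eventually_mono\<close>)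
qed

lemma coeff_tendsto_unique:
  assumes "F \<noteq> bot" "coeff_tendsto X K F" "coeff_tendsto X L F"
  shows "K = L"
  using assms unfolding coeff_tendsto_def by (intro ncps_eqI) (blast intro: tendsto_unique)

lemma ncps_on_mult:
  assumes "f \<in> ncps_on V" "g \<in> ncps_on V"
  shows "f * g \<in> ncps_on V"
  unfolding ncps_on_def
proof (intro CollectI allI impI)
  fix w :: "'a list" assume w: "\<not> set w \<subseteq> V"
  show "nc_coeff (f * g) w = 0"
    unfolding nc_coeff_mult
  proof (intro sum.neutral ballI)
    fix i
    have "set w = set (take i w) \<union> set (drop i w)" by (metis append_take_drop_id set_append)
    then have "\<not> set (take i w) \<subseteq> V \<or> \<not> set (drop i w) \<subseteq> V" using w by blast
    then show "nc_coeff f (take i w) * nc_coeff g (drop i w) = 0"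
      using assms unfolding ncps_on_def by auto
  qed
qed

lemma linear_subst_in: "linear_subst V M f \<in> ncps_on V"
  by (simp add: ncps_on_def nc_coeff_linear_subst)

lemma nc_coeff_mult_Cons:
  "nc_coeff (f * g) (v # w) = nc_coeff f [] * nc_coeff g (v # w) +
     (\<Sum>i\<le>length w. nc_coeff f (v # take i w) * nc_coeff g (drop i w))"
  by (simp add: nc_coeff_mult sum.atMost_Suc_shift del: sum.atMost_Suc)

lemma nc_coeff_linear_subst_Cons:
  assumes "v \<in> V" "set w \<subseteq> V"
  shows "nc_coeff (linear_subst V M f) (v # w) =
     (\<Sum>u\<in>V. \<Sum>x\<in>words V (length w). M v u * word_weight M w x * nc_coeff f (u # x))"
proof -
  have "(\<Sum>x\<in>words V (Suc (length w)). word_weight M (v # w) x * nc_coeff f x) =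
      (\<Sum>(u, x)\<in>V \<times> words V (length w). M v u * word_weight M w x * nc_coeff f (u # x))"
    by (rule sum.reindex_bij_witness[where i = "\<lambda>(u, x). u # x" and j = "\<lambda>x. (hd x, tl x)"])
      (auto simp: words_def word_weight_def length_Suc_conv)
  then show ?thesis using assms by (simp add: nc_coeff_linear_subst sum.cartesian_product)
qed

lemma horizontal_compose:
  assumes X: "horizontal V \<eta> X"
    and g: "\<And>z. z \<in> upper_half_plane \<Longrightarrow> g z \<in> upper_half_plane" "g holomorphic_on upper_half_plane"
  shows "horizontal V (\<lambda>v. pullback g (\<eta> v)) (\<lambda>z. X (g z))"
proof -
  have dg: "(g has_field_derivative deriv g z) (at z)" if "z \<in> upper_half_plane" for z
    using g(2) open_upper_half_plane that by (rule holomorphic_derivI)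
  have "((\<lambda>z. nc_coeff (X (g z)) []) has_field_derivative 0) (at z)" if z: "z \<in> upper_half_plane" for z
  proof -
    have "((\<lambda>z. nc_coeff (X z) []) has_field_derivative 0) (at (g z))"
      using X g(1)[OF z] by (simp add: horizontal_def)
    from DERIV_chain2[OF this dg[OF z]] show ?thesis by simp
  qed
  moreover have "((\<lambda>z. nc_coeff (X (g z)) (v # w)) has_field_derivative
      pullback g (\<eta> v) z * nc_coeff (X (g z)) w) (at z)"
    if z: "z \<in> upper_half_plane" and v: "v \<in> V" "set w \<subseteq> V" for z v w
  proof -
    have "((\<lambda>z. nc_coeff (X z) (v # w)) has_field_derivative \<eta> v (g z) * nc_coeff (X (g z)) w) (at (g z))"
      using X g(1)[OF z] v by (simp add: horizontal_def)
    from DERIV_chain2[OF this dg[OF z]] show ?thesis by (simp add: pullback_def mult_ac)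
  qed
  ultimately show ?thesis using X g(1) by (simp add: horizontal_def)
qed

text \<open>Substitution turns the connection form \<open>\<Sum>u. A\<^sub>u \<omega>\<^sub>u\<close> into \<open>\<Sum>v. A\<^sub>v (\<Sum>u. M v u \<omega>\<^sub>u)\<close>; the transposition of
  indices in the action on the variables is what makes this the form with coefficients \<open>\<eta>\<^sub>v\<close>.\<close>
lemma horizontal_linear_subst:
  assumes X: "horizontal V \<omega> X"
    and M: "\<And>v z. v \<in> V \<Longrightarrow> z \<in> upper_half_plane \<Longrightarrow> \<eta> v z = (\<Sum>u\<in>V. M v u * \<omega> u z)"
  shows "horizontal V \<eta> (\<lambda>z. linear_subst V M (X z))"
proof -
  have "((\<lambda>z. nc_coeff (linear_subst V M (X z)) []) has_field_derivative 0) (at z)"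
    if "z \<in> upper_half_plane" for z
    using X that by (simp add: horizontal_def nc_coeff_linear_subst word_weight_def)
  moreover have "((\<lambda>z. nc_coeff (linear_subst V M (X z)) (v # w)) has_field_derivative
      \<eta> v z * nc_coeff (linear_subst V M (X z)) w) (at z)"
    if z: "z \<in> upper_half_plane" and v: "v \<in> V" "set w \<subseteq> V" for z v w
  proof -
    have "((\<lambda>z. nc_coeff (linear_subst V M (X z)) (v # w)) has_field_derivative
      (\<Sum>u\<in>V. \<Sum>x\<in>words V (length w). M v u * word_weight M w x * (\<omega> u z * nc_coeff (X z) x))) (at z)"
      unfolding nc_coeff_linear_subst_Cons[OF v]
    proof (intro DERIV_sum DERIV_cmult)
      fix u x assume "u \<in> V" "x \<in> words V (length w)"
      then show "((\<lambda>z. nc_coeff (X z) (u # x)) has_field_derivative \<omega> u z * nc_coeff (X z) x) (at z)"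
        using X z by (auto simp: horizontal_def words_def)
    qed
    also have "(\<Sum>u\<in>V. \<Sum>x\<in>words V (length w). M v u * word_weight M w x * (\<omega> u z * nc_coeff (X z) x))
        = \<eta> v z * nc_coeff (linear_subst V M (X z)) w"
      using v by (simp add: M[OF v(1) z] nc_coeff_linear_subst sum_product mult_ac)
    finally show ?thesis .
  qed
  ultimately show ?thesis by (simp add: horizontal_def linear_subst_in)
qed

text \<open>The equation acts by multiplication on the left, so constant right factors survive.\<close>
lemma horizontal_mult_right:
  assumes X: "horizontal V \<eta> X" and J: "J \<in> ncps_on V"
  shows "horizontal V \<eta> (\<lambda>z. X z * J)"
proof -
  have "((\<lambda>z. nc_coeff (X z * J) []) has_field_derivative 0) (at z)" if "z \<in> upper_half_plane" for z
  proof -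
    have "((\<lambda>z. nc_coeff (X z) []) has_field_derivative 0) (at z)" using X that by (simp add: horizontal_def)
    from DERIV_cmult_right[OF this] show ?thesis by (simp add: nc_coeff_mult)
  qed
  moreover have "((\<lambda>z. nc_coeff (X z * J) (v # w)) has_field_derivative
      \<eta> v z * nc_coeff (X z * J) w) (at z)"
    if z: "z \<in> upper_half_plane" and v: "v \<in> V" "set w \<subseteq> V" for z v w
  proof -
    have "((\<lambda>z. nc_coeff (X z * J) (v # w)) has_field_derivative 0 * nc_coeff J (v # w) +
        (\<Sum>i\<le>length w. (\<eta> v z * nc_coeff (X z) (take i w)) * nc_coeff J (drop i w))) (at z)"
      unfolding nc_coeff_mult_Cons
    proof (intro DERIV_add DERIV_sum DERIV_cmult_right)
      fix i
      have "set (take i w) \<subseteq> V" using v by (auto dest: in_set_takeD)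
      then show "((\<lambda>z. nc_coeff (X z) (v # take i w)) has_field_derivative
          \<eta> v z * nc_coeff (X z) (take i w)) (at z)"
        using X z v by (simp add: horizontal_def)
    qed (use X z in \<open>simp add: horizontal_def\<close>)
    then show ?thesis by (simp add: nc_coeff_mult sum_distrib_left mult_ac)
  qed
  ultimately show ?thesis using X J by (simp add: horizontal_def ncps_on_mult)
qed

text \<open>The equation is linear and strictly triangular in the length of words: once the solutions agree
  on \<open>w\<close>, their difference at \<open>v # w\<close> has derivative \<open>0\<close>, and the limit along \<open>p\<close> shows that this constant
  is \<open>0\<close>. Since the comparison point may be a cusp, \<open>p\<close> need not converge in the half plane.\<close>
lemma horizontal_unique:
  assumes X: "horizontal V \<eta> X" and Y: "horizontal V \<eta> Y"
    and F: "F \<noteq> bot" "\<forall>\<^sub>F x in F. p x \<in> upper_half_plane"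
    and lim: "coeff_tendsto (\<lambda>x. X (p x)) L F" "coeff_tendsto (\<lambda>x. Y (p x)) L F"
    and z: "z \<in> upper_half_plane"
  shows "X z = Y z"
proof -
  have const: "nc_coeff (X z) w = nc_coeff (Y z) w"
    if D: "\<And>z. z \<in> upper_half_plane \<Longrightarrow>
      ((\<lambda>z. nc_coeff (X z) w - nc_coeff (Y z) w) has_field_derivative 0) (at z)"
      and z: "z \<in> upper_half_plane" for z w
  proof -
    obtain c where c: "\<And>z. z \<in> upper_half_plane \<Longrightarrow> nc_coeff (X z) w - nc_coeff (Y z) w = c"
      using has_field_derivative_zero_constant[OF convex_upper_half_plane
          has_field_derivative_at_within[OF D]] by blast
    have "((\<lambda>x. nc_coeff (X (p x)) w - nc_coeff (Y (p x)) w) \<longlongrightarrow> nc_coeff L w - nc_coeff L w) F"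
      using lim by (intro tendsto_diff) (auto simp: coeff_tendsto_def)
    then have "((\<lambda>x. c) \<longlongrightarrow> nc_coeff L w - nc_coeff L w) F"
      by (rule Lim_transform_eventually) (use F(2) c in \<open>auto elim: eventually_mono\<close>)
    then have "c = 0" using F(1) by (simp add: tendsto_const_iff)
    then show ?thesis using c[OF z] by simp
  qed
  have eq: "nc_coeff (X z) w = nc_coeff (Y z) w" if "set w \<subseteq> V" "z \<in> upper_half_plane" for z w
    using that
  proof (induction w arbitrary: z)
    case Nil
    show ?case
    proof (rule const)
      fix z assume "z \<in> upper_half_plane"
      then have "((\<lambda>z. nc_coeff (X z) [] - nc_coeff (Y z) []) has_field_derivative 0 - 0) (at z)"
        using X Y by (intro DERIV_diff) (auto simp: horizontal_def)
      then show "((\<lambda>z. nc_coeff (X z) [] - nc_coeff (Y z) []) has_field_derivative 0) (at z)" by simp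
    qed (use Nil in simp)
  next
    case (Cons v w)
    show ?case
    proof (rule const)
      fix z assume z: "z \<in> upper_half_plane"
      have "((\<lambda>z. nc_coeff (X z) (v # w) - nc_coeff (Y z) (v # w)) has_field_derivative
          \<eta> v z * nc_coeff (X z) w - \<eta> v z * nc_coeff (Y z) w) (at z)"
        using X Y z Cons.prems by (intro DERIV_diff) (auto simp: horizontal_def)
      then show "((\<lambda>z. nc_coeff (X z) (v # w) - nc_coeff (Y z) (v # w)) has_field_derivative 0) (at z)"
        using Cons.IH[OF _ z] Cons.prems by simp
    qed (use Cons in simp)
  qed
  show ?thesis
  proof (rule ncps_eqI)
    fix w
    show "nc_coeff (X z) w = nc_coeff (Y z) w"
    proof (cases "set w \<subseteq> V")
      case False
      then show ?thesis using X Y z by (auto simp: horizontal_def ncps_on_def)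
    qed (use eq z in blast)
  qed
qed

section \<open>The total iterated integral and its transformation\<close>

context vanishing_forms
begin

text \<open>The generating series \<open>J\<^sub>0\<^sup>z\<close> of the iterated integrals from \<open>0\<close> to \<open>z\<close>.\<close>
definition path_series :: "complex \<Rightarrow> 'v ncps" where
  "path_series z = Abs_ncps (\<lambda>w. if set w \<subseteq> V then iterated_primitive \<omega> w z else 0)"

lemma nc_coeff_path_series:
  "nc_coeff (path_series z) w = (if set w \<subseteq> V then iterated_primitive \<omega> w z else 0)"
  by (simp add: path_series_def Abs_ncps_inverse)

lemma horizontal_path_series: "horizontal V \<omega> path_series"
  unfolding horizontal_def by (auto simp: nc_coeff_path_series ncps_on_def intro: has_field_derivative_iterated_primitive)

lemma path_series_at_0: "coeff_tendsto (\<lambda>y. path_series (\<i> * of_real y)) 1 (at_right 0)"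
  unfolding coeff_tendsto_def
proof
  fix w :: "'v list"
  show "((\<lambda>y. nc_coeff (path_series (\<i> * of_real y)) w) \<longlongrightarrow> nc_coeff 1 w) (at_right 0)"
    using iterated_primitive_at_0[of w] by (cases "set w \<subseteq> V") (auto simp: nc_coeff_path_series)
qed

lemma path_series_at_top:
  assumes "\<bar>x\<bar> \<le> 1"
  shows "coeff_tendsto (\<lambda>y. path_series (\<i> * of_real y + of_real x)) (J_series V \<omega>) at_top"
  unfolding coeff_tendsto_def
proof
  fix w :: "'v list"
  show "((\<lambda>y. nc_coeff (path_series (\<i> * of_real y + of_real x)) w) \<longlongrightarrow> nc_coeff (J_series V \<omega>) w) at_top"
    using iterated_primitive_at_top_strip[OF _ assms, of w]
    by (cases "set w \<subseteq> V"; cases "w = []") (auto simp: nc_coeff_path_series nc_coeff_J_series)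
qed

text \<open>Composition with \<open>g\<close> and the substitution by the pull-back matrix both carry \<open>J\<^sub>0\<^sup>z\<close> to horizontal
  series for the forms pulled back by \<open>g\<close>, so the two differ by a constant right factor. That factor is the
  value of \<open>J\<^sub>0\<^sup>g\<^sup>z\<close> at \<open>z = 0\<close>, which is the total integral when \<open>g 0 = \<i>\<infinity>\<close>.\<close>
lemma path_series_transport:
  assumes g: "\<And>z. z \<in> upper_half_plane \<Longrightarrow> moebius g z \<in> upper_half_plane"
      "moebius g holomorphic_on upper_half_plane"
    and M: "pullback_matrix g V \<omega> M"
    and lim: "coeff_tendsto (\<lambda>y. path_series (moebius g (\<i> * of_real y))) (J_series V \<omega>) (at_right 0)"
    and z: "z \<in> upper_half_plane"
  shows "path_series (moebius g z) = linear_subst V M (path_series z) * J_series V \<omega>"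
proof (rule horizontal_unique[where p = "\<lambda>y. \<i> * of_real y" and F = "at_right (0::real)"])
  show "horizontal V (\<lambda>v. pullback (moebius g) (\<omega> v)) (\<lambda>z. path_series (moebius g z))"
    by (rule horizontal_compose[OF horizontal_path_series g])
  show "horizontal V (\<lambda>v. pullback (moebius g) (\<omega> v)) (\<lambda>z. linear_subst V M (path_series z) * J_series V \<omega>)"
    using M by (intro horizontal_mult_right horizontal_linear_subst[OF horizontal_path_series] J_series_in)
      (simp add: pullback_matrix_def)
  have "linear_subst V M 1 = 1"
  proof (rule ncps_eqI)
    fix w
    show "nc_coeff (linear_subst V M 1) w = nc_coeff 1 w"
    proof (cases "w = []")
      case False
      then show ?thesis by (auto simp: nc_coeff_linear_subst words_def intro!: sum.neutral)
    qed (simp add: nc_coeff_linear_subst word_weight_def)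
  qed
  then show "coeff_tendsto (\<lambda>y. linear_subst V M (path_series (\<i> * of_real y)) * J_series V \<omega>) (J_series V \<omega>) (at_right 0)"
    using coeff_tendsto_mult[OF coeff_tendsto_linear_subst[OF path_series_at_0] coeff_tendsto_const, of V M "J_series V \<omega>"]
    by simp
  show "\<forall>\<^sub>F y in at_right 0. \<i> * complex_of_real y \<in> upper_half_plane"
    using eventually_at_right_less[of "0::real"] by eventually_elim (simp add: upper_half_plane_def)
qed (use lim z in auto)

text \<open>\<open>\<sigma>\<close> reverses the imaginary axis.\<close>
lemma path_series_sigma:
  assumes "pullback_matrix sigma_mat V \<omega> S" "z \<in> upper_half_plane"
  shows "path_series (moebius sigma_mat z) = linear_subst V S (path_series z) * J_series V \<omega>"
proof (rule path_series_transport[OF moebius_sigma_in _ assms(1) _ assms(2)])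
  show "moebius sigma_mat holomorphic_on upper_half_plane"
    unfolding moebius_sigma[abs_def] by (auto intro!: holomorphic_intros simp: upper_half_plane_def)
  have "coeff_tendsto (\<lambda>y. path_series (\<i> * of_real (inverse y))) (J_series V \<omega>) (at_right 0)"
    using coeff_tendsto_compose[OF path_series_at_top[of 0] filterlim_inverse_at_top_right] by simp
  moreover have "moebius sigma_mat (\<i> * of_real y) = \<i> * of_real (inverse y)" for y
    by (simp add: moebius_sigma divide_inverse)
  ultimately show "coeff_tendsto (\<lambda>y. path_series (moebius sigma_mat (\<i> * of_real y))) (J_series V \<omega>) (at_right 0)"
    by simp
qed

text \<open>\<open>\<tau>\<close> maps the imaginary axis to the line \<open>Re z = 1\<close>, traversed downwards from \<open>\<i>\<infinity>\<close>; this is the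
  reason for controlling limits on a strip.\<close>
lemma path_series_tau:
  assumes "pullback_matrix tau_mat V \<omega> T" "z \<in> upper_half_plane"
  shows "path_series (moebius tau_mat z) = linear_subst V T (path_series z) * J_series V \<omega>"
proof (rule path_series_transport[OF moebius_tau_in _ assms(1) _ assms(2)])
  show "moebius tau_mat holomorphic_on upper_half_plane"
    unfolding moebius_tau[abs_def] by (auto intro!: holomorphic_intros simp: upper_half_plane_def)
  have "coeff_tendsto (\<lambda>y. path_series (\<i> * of_real (inverse y) + of_real 1)) (J_series V \<omega>) (at_right 0)"
    using coeff_tendsto_compose[OF path_series_at_top[of 1] filterlim_inverse_at_top_right] by simp
  moreover have "\<forall>\<^sub>F y in at_right 0. path_series (\<i> * of_real (inverse y) + of_real 1)
      = path_series (moebius tau_mat (\<i> * of_real y))"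
    using eventually_at_right_less[of "0::real"]
  proof eventually_elim
    case (elim y)
    then have "moebius tau_mat (\<i> * of_real y) = \<i> * of_real (inverse y) + of_real 1"
      by (simp add: moebius_tau complex_eq_iff Re_divide Im_divide power2_eq_square field_simps)
    then show ?case by simp
  qed
  ultimately show "coeff_tendsto (\<lambda>y. path_series (moebius tau_mat (\<i> * of_real y))) (J_series V \<omega>) (at_right 0)"
    by (rule coeff_tendsto_eventually_eq)
qed

text \<open>Let \<open>z\<close> tend to \<open>\<i>\<infinity>\<close> in the transformation rule: \<open>\<sigma> z\<close> tends to \<open>0\<close>.\<close>
lemma sigma_relation:
  assumes S: "pullback_matrix sigma_mat V \<omega> S"
  shows "linear_subst V S (J_series V \<omega>) * J_series V \<omega> = 1"
proof (rule coeff_tendsto_unique[of at_top "\<lambda>y. path_series (moebius sigma_mat (\<i> * of_real y))"])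
  have "moebius sigma_mat (\<i> * of_real y) = \<i> * of_real (inverse y)" for y
    by (simp add: moebius_sigma divide_inverse)
  then show "coeff_tendsto (\<lambda>y. path_series (moebius sigma_mat (\<i> * of_real y))) 1 at_top"
    using coeff_tendsto_compose[OF path_series_at_0 filterlim_inverse_at_right_top] by simp
  have "coeff_tendsto (\<lambda>y. linear_subst V S (path_series (\<i> * of_real y)) * J_series V \<omega>)
      (linear_subst V S (J_series V \<omega>) * J_series V \<omega>) at_top"
    using path_series_at_top[of 0] by (intro coeff_tendsto_mult coeff_tendsto_linear_subst coeff_tendsto_const) simp
  moreover have "\<forall>\<^sub>F y in at_top. linear_subst V S (path_series (\<i> * of_real y)) * J_series V \<omega>
      = path_series (moebius sigma_mat (\<i> * of_real y))"
    using eventually_gt_at_top[of 0]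
    by eventually_elim (simp add: path_series_sigma[OF S] upper_half_plane_def)
  ultimately show "coeff_tendsto (\<lambda>y. path_series (moebius sigma_mat (\<i> * of_real y)))
      (linear_subst V S (J_series V \<omega>) * J_series V \<omega>) at_top"
    by (rule coeff_tendsto_eventually_eq)
qed simp

text \<open>Apply the rule for \<open>\<tau>\<close> twice and let \<open>z\<close> tend to \<open>\<i>\<infinity>\<close>. The factors converge to the three factors
  of the relation. The image \<open>\<tau> (\<tau> z)\<close> tends to \<open>0\<close>, but along a geodesic other than the imaginary axis;
  as it equals \<open>\<sigma> (z - 1)\<close>, the rule for \<open>\<sigma>\<close> moves the limit to the line \<open>Re z = - 1\<close> near \<open>\<i>\<infinity>\<close>. That
  the limit is \<open>1\<close> is then the relation for \<open>\<sigma>\<close>.\<close>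
lemma tau_relation:
  assumes S: "pullback_matrix sigma_mat V \<omega> S" and T: "pullback_matrix tau_mat V \<omega> T"
  shows "linear_subst V T (linear_subst V T (J_series V \<omega>)) * linear_subst V T (J_series V \<omega>) * J_series V \<omega> = 1"
proof (rule coeff_tendsto_unique[of at_top "\<lambda>y. path_series (moebius tau_mat (moebius tau_mat (\<i> * of_real y)))"])
  let ?J = "J_series V \<omega>"
  let ?t = "linear_subst V T"
  have "coeff_tendsto (\<lambda>y. linear_subst V S (path_series (\<i> * of_real y + of_real (- 1))) * ?J)
      (linear_subst V S ?J * ?J) at_top"
    by (intro coeff_tendsto_mult coeff_tendsto_linear_subst coeff_tendsto_const path_series_at_top) simp
  moreover have "\<forall>\<^sub>F y in at_top. linear_subst V S (path_series (\<i> * of_real y + of_real (- 1))) * ?J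
      = path_series (moebius tau_mat (moebius tau_mat (\<i> * of_real y)))"
    using eventually_gt_at_top[of 0]
  proof eventually_elim
    case (elim y)
    let ?z = "\<i> * of_real y + of_real (- 1) :: complex"
    have "moebius tau_mat (moebius tau_mat (\<i> * of_real y)) = moebius sigma_mat ?z"
    proof -
      have "\<i> * of_real y \<noteq> 0" "?z \<noteq> 0" "\<i> * of_real y - 1 \<noteq> (0::complex)"
        using elim by (auto simp: complex_eq_iff)
      then show ?thesis by (simp add: moebius_sigma moebius_tau field_simps)
    qed
    then show ?case using elim by (simp add: path_series_sigma[OF S] upper_half_plane_def)
  qed
  ultimately show "coeff_tendsto (\<lambda>y. path_series (moebius tau_mat (moebius tau_mat (\<i> * of_real y)))) 1 at_top"
    unfolding sigma_relation[OF S] by (rule coeff_tendsto_eventually_eq)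
  have "coeff_tendsto (\<lambda>y. ?t (?t (path_series (\<i> * of_real y)) * ?J) * ?J) (?t (?t ?J * ?J) * ?J) at_top"
    using path_series_at_top[of 0] by (intro coeff_tendsto_mult coeff_tendsto_linear_subst coeff_tendsto_const) simp
  moreover have "\<forall>\<^sub>F y in at_top. ?t (?t (path_series (\<i> * of_real y)) * ?J) * ?J
      = path_series (moebius tau_mat (moebius tau_mat (\<i> * of_real y)))"
    using eventually_gt_at_top[of 0]
  proof eventually_elim
    case (elim y)
    then have z: "\<i> * of_real y \<in> upper_half_plane" by (simp add: upper_half_plane_def)
    show ?case
      by (simp only: path_series_tau[OF T z] path_series_tau[OF T moebius_tau_in[OF z]])
  qed
  ultimately show "coeff_tendsto (\<lambda>y. path_series (moebius tau_mat (moebius tau_mat (\<i> * of_real y))))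
      (?t (?t ?J) * ?t ?J * ?J) at_top"
    unfolding linear_subst_mult by (rule coeff_tendsto_eventually_eq)
qed simp

end

theorem proposition5p1p1:
  fixes V :: "'v set"
    and \<omega> :: "'v \<Rightarrow> one_form"
    and S T :: "'v \<Rightarrow> 'v \<Rightarrow> complex"
    and sigma_star tau_star :: "'v ncps \<Rightarrow> 'v ncps"
  assumes "finite V"
    and "\<forall>v\<in>V. cusp_modular_type (\<omega> v)"
    and "span_stable sigma_mat V \<omega>"
    and "span_stable tau_mat V \<omega>"
    and "pullback_matrix sigma_mat V \<omega> S"
    and "pullback_matrix tau_mat V \<omega> T"
    and "induced_endo V S sigma_star"
    and "induced_endo V T tau_star"
  shows "sigma_star (J_series V \<omega>) * J_series V \<omega> = 1 \<and>
         tau_star (tau_star (J_series V \<omega>)) * tau_star (J_series V \<omega>) * J_series V \<omega> = 1"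
proof -
  interpret vanishing_forms V \<omega>
    by (rule vanishing_forms_cusp_modular_type[OF assms(2,5)])
  have sigma: "sigma_star f = linear_subst V S f" if "f \<in> ncps_on V" for f
    by (rule induced_endo_unique[OF assms(1,7) induced_endo_linear_subst[OF assms(1)] that])
  have tau: "tau_star f = linear_subst V T f" if "f \<in> ncps_on V" for f
    by (rule induced_endo_unique[OF assms(1,8) induced_endo_linear_subst[OF assms(1)] that])
  show ?thesis
    using sigma_relation[OF assms(5)] tau_relation[OF assms(5,6)]
    by (simp add: sigma tau J_series_in linear_subst_in)
qed

end
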